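(* Let $n\ge1$, $w\in\mathbb{R}^n_{>0}$, $1/2\le\beta<1$, $c_0\in\mathbb{R}^n$, $r_0>0$, $B_0=\mathcal{B}(c_0,r_0w)$, $x^*\in B_0$, $f\in\mathcal{U}(x^*,B_0)$. Run Cube-Vote with an odd number $m$ of noisy sign queries per step (noise margin $\gamma>0$), and let $p_m$ be an upper bound, uniform over points and histories, on the conditional probability that the majority errs in a given coordinate with $\partial_if\ne0$; by Hoeffding's inequality $p_m=e^{-2\gamma^2m}$ is admissible. Then: (i) for every $i$, $\displaystyle\mathbb{E}\lim_{k\to\infty}\frac{|c_{k,i}-x_i^*|}{w_i}\le2p_mr_0$; (ii) $\displaystyle\mathbb{E}\lim_{k\to\infty}M_k\le2r_0\min\{1,np_m\}$, and, if the answers are conditionally independent across coordinates, also $\mathbb{E}\lim_kM_k\le2r_0[1-(1-p_m)^n]$; for a finite number $K$ of steps the remainder $\beta^Kr_0$ is to be added, i.e. $\mathbb{E}M_K$ is bounded by the same expressions plus $\beta^Kr_0$; (iii) for any $K$ and $\delta\in(0,1)$, if $m\ge\frac{1}{2\gamma^2}\ln\frac{nK}{\delta}$, then with probability at least $1-\delta$ all signs on the first $K$ steps are correct and $M_K\le\beta^Kr_0$.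
   Context: $\mathcal{B}(c,r)=\{x:|x_i-c_i|\le r_i\ \forall i\}$; $R_k=\beta^kr_0$; $M_k=\max_i|c_{k,i}-x_i^*|/w_i$. Class $\mathcal{U}(x^*,B)$: functions $f$ differentiable on a neighbourhood of $B$ with $\partial_if(x)(x_i-x_i^* )>0$ for every $x\in B$ and every $i$ with $x_i\ne x_i^*$. Noise model: a query at $x$ returns $\hat s\in\{-1,1\}^n$ such that, for every coordinate with $\partial_if(x)\ne0$, $\mathbb{P}[\hat s_i=\operatorname{sign}\partial_if(x)\mid\mathcal{H}]\ge\tfrac12+\gamma$ conditionally on any history $\mathcal{H}$; the answers are conditionally independent across queries (independence across coordinates is not assumed unless stated). In coordinates with $\partial_if(x)=0$ the answer is arbitrary. Cube-Vote: at step $k$ make $m$ (odd) queries at $c_k$, let $s_k\in\{-1,1\}^n$ be the coordinatewise majority of the answers, and set $c_{k+1}=c_k-(1-\beta)R_k\,w\odot s_k$. The sign at step $k$ in coordinate $i$ is correct if $s_{k,i}=\operatorname{sign}\partial_if(c_k)$ whenever $\partial_if(c_k)\ne0$ (no requirement when $\partial_if(c_k)=0$). *)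

theory Defs
  imports "HOL-Probability.Probability"
begin

definition coord_box :: "real ^ 'n \<Rightarrow> real ^ 'n \<Rightarrow> (real ^ 'n) set" where
  "coord_box c r = {x. \<forall>i. \<bar>x $ i - c $ i\<bar> \<le> r $ i}"

definition pderiv_at :: "'n \<Rightarrow> (real ^ 'n \<Rightarrow> real) \<Rightarrow> real ^ 'n \<Rightarrow> real" where
  "pderiv_at i f x = deriv (\<lambda>t. f (x + t *\<^sub>R axis i 1)) 0"

definition class_U :: "real ^ 'n \<Rightarrow> (real ^ 'n) set \<Rightarrow> (real ^ 'n \<Rightarrow> real) set" where
  "class_U xs B = {f. (\<exists>U. open U \<and> B \<subseteq> U \<and> f differentiable_on U) \<and>
     (\<forall>x\<in>B. \<forall>i. x $ i \<noteq> xs $ i \<longrightarrow> pderiv_at i f x * (x $ i - xs $ i) > 0)}"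

definition sign_correct :: "(real ^ 'n \<Rightarrow> real) \<Rightarrow> real ^ 'n \<Rightarrow> real ^ 'n \<Rightarrow> 'n \<Rightarrow> bool" where
  "sign_correct f x s i \<longleftrightarrow> (pderiv_at i f x \<noteq> 0 \<longrightarrow> s $ i = sgn (pderiv_at i f x))"

definition majority :: "nat \<Rightarrow> (nat \<Rightarrow> real ^ 'n) \<Rightarrow> real ^ 'n" where
  "majority m a = (\<chi> i. if card {j. j < m \<and> a j $ i = 1} > card {j. j < m \<and> a j $ i = -1}
                        then 1 else -1)"

text \<open>The run is a deterministic function of the table of answers: \<open>a k j\<close> is the answer
  to the \<open>j\<close>-th query (\<open>j < m\<close>) of step \<open>k\<close>.\<close>

primrec center ::
  "real \<Rightarrow> real \<Rightarrow> real ^ 'n \<Rightarrow> real ^ 'n \<Rightarrow> nat \<Rightarrow> (nat \<Rightarrow> nat \<Rightarrow> real ^ 'n) \<Rightarrow> nat \<Rightarrow> real ^ 'n"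
where
  "center \<beta> r0 w c0 m a 0 = c0"
| "center \<beta> r0 w c0 m a (Suc k) =
     center \<beta> r0 w c0 m a k - (\<chi> i. (1 - \<beta>) * (\<beta> ^ k * r0) * w $ i * majority m (a k) $ i)"

definition max_err :: "real ^ 'n \<Rightarrow> real ^ 'n \<Rightarrow> real ^ 'n \<Rightarrow> real" where
  "max_err w xs c = Max (range (\<lambda>i. \<bar>c $ i - xs $ i\<bar> / w $ i))"

definition cprob :: "'a measure \<Rightarrow> 'a measure \<Rightarrow> ('a \<Rightarrow> bool) \<Rightarrow> 'a \<Rightarrow> real" where
  "cprob M G P = real_cond_exp M G (indicator {\<omega> \<in> space M. P \<omega>})"

text \<open>Conditional independence, given \<open>G\<close>, of a finite family of random variables with values
  in \<open>N\<close>. Subfamilies are covered by taking \<open>S j = space N\<close>.\<close>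

definition cond_indep_family ::
  "'a measure \<Rightarrow> 'a measure \<Rightarrow> 'b measure \<Rightarrow> 'j set \<Rightarrow> ('j \<Rightarrow> 'a \<Rightarrow> 'b) \<Rightarrow> bool" where
  "cond_indep_family M G N J X \<longleftrightarrow>
     (\<forall>S. (\<forall>j\<in>J. S j \<in> sets N) \<longrightarrow>
        (AE \<omega> in M. cprob M G (\<lambda>\<omega>'. \<forall>j\<in>J. X j \<omega>' \<in> S j) \<omega> =
                    (\<Prod>j\<in>J. cprob M G (\<lambda>\<omega>'. X j \<omega>' \<in> S j) \<omega>)))"

text \<open>\<open>H k\<close> is the history before step \<open>k\<close>. It contains all answers of the earlier steps and
  possibly further information, so the answers may depend on the past. Within a step the \<open>m\<close>
  answers are conditionally independent given \<open>H k\<close>; hence the bound given \<open>H k\<close> also holds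
  given \<open>H k\<close> together with the other answers of the same step.
  \<open>c k \<omega>\<close> is the point queried at step \<open>k\<close>.\<close>

definition noise_model ::
  "'a measure \<Rightarrow> (nat \<Rightarrow> 'a measure) \<Rightarrow> nat \<Rightarrow> real \<Rightarrow> (real ^ 'n \<Rightarrow> real) \<Rightarrow>
   (nat \<Rightarrow> nat \<Rightarrow> 'a \<Rightarrow> real ^ 'n) \<Rightarrow> (nat \<Rightarrow> 'a \<Rightarrow> real ^ 'n) \<Rightarrow> bool" where
  "noise_model M H m \<gamma> f A c \<longleftrightarrow>
     filtration (space M) H \<and>
     (\<forall>k. subalgebra M (H k)) \<and>
     (\<forall>k. \<forall>j<m. A k j \<in> borel_measurable (H (Suc k))) \<and>
     (\<forall>k. \<forall>j<m. \<forall>\<omega>\<in>space M. \<forall>i. A k j \<omega> $ i \<in> {-1, 1}) \<and>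
     (\<forall>k. \<forall>j<m. \<forall>i. AE \<omega> in M. pderiv_at i f (c k \<omega>) \<noteq> 0 \<longrightarrow>
        cprob M (H k) (\<lambda>\<omega>'. A k j \<omega>' $ i = sgn (pderiv_at i f (c k \<omega>'))) \<omega> \<ge> 1 / 2 + \<gamma>) \<and>
     (\<forall>k. cond_indep_family M (H k) borel {..<m} (A k))"

definition indep_across_coords ::
  "'a measure \<Rightarrow> (nat \<Rightarrow> 'a measure) \<Rightarrow> nat \<Rightarrow> (nat \<Rightarrow> nat \<Rightarrow> 'a \<Rightarrow> real ^ 'n) \<Rightarrow> bool" where
  "indep_across_coords M H m A \<longleftrightarrow>
     (\<forall>k. \<forall>j<m. cond_indep_family M (H k) borel UNIV (\<lambda>i \<omega>. A k j \<omega> $ i))"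

definition majority_err_bound ::
  "'a measure \<Rightarrow> (nat \<Rightarrow> 'a measure) \<Rightarrow> nat \<Rightarrow> (real ^ 'n \<Rightarrow> real) \<Rightarrow>
   (nat \<Rightarrow> nat \<Rightarrow> 'a \<Rightarrow> real ^ 'n) \<Rightarrow> (nat \<Rightarrow> 'a \<Rightarrow> real ^ 'n) \<Rightarrow> real \<Rightarrow> bool" where
  "majority_err_bound M H m f A c p \<longleftrightarrow>
     (\<forall>k i. AE \<omega> in M. pderiv_at i f (c k \<omega>) \<noteq> 0 \<longrightarrow>
        cprob M (H k) (\<lambda>\<omega>'. \<not> sign_correct f (c k \<omega>') (majority m (\<lambda>j. A k j \<omega>')) i) \<omega> \<le> p)"

end

theory Submission
  imports Defs
begin

text \<open>
Let \<open>R k = \<beta> ^ k * r0\<close> be the radius at step \<open>k\<close>. The naive argument (after the first wrong sign the center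
moves by at most the remaining radius) charges every wrong step \<open>2 * R k\<close>, which sums to
\<open>2 * r0 / (1 - \<beta>)\<close>. The proof follows instead the excess of the normalised error over the
radius. A correct step never increases the excess, since both the error and the radius lose the step
length, and an overshoot past the target is covered by the new radius because \<open>\<beta> \<ge> 1 / 2\<close>. A wrong step
increases it by at most \<open>2 * (1 - \<beta>) * R k\<close>. So, for every outcome, the error after \<open>K\<close> steps is at most
\<open>R K\<close> plus the sum of these increments over the wrong steps (\<open>abs_error_le_sum_wrong\<close>), and
the increments of all steps together sum to \<open>2 * r0\<close>. If every step is wrong with probability at most
\<open>q\<close>, the expected error is therefore at most \<open>2 * r0 * q + R K\<close>, and the limit follows by dominated
convergence (\<open>expectation_error_bounds\<close>). The same argument applies to a single coordinate and to the
maximum; only the meaning of a wrong step changes. In a single coordinate \<open>q\<close> is \<open>p\<close>. For the maximum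
it is \<open>min 1 (n * p)\<close> by the union bound, or \<open>1 - (1 - p) ^ n\<close> under independence across
coordinates (\<open>prob_some_wrong_le_indep\<close>).

The probabilistic part rests on a finiteness remark: the \<open>k\<close>-th center is a function of finitely many
signs, so it takes finitely many values, each on an event of the history. Given the history, the center can
therefore be replaced by a constant (\<open>cprob_freeze\<close>), and the conditional law of a round of answers
becomes, at almost every outcome, a finite product distribution. The Hoeffding estimate is then a
Chernoff bound for finite sums (\<open>vote_tail\<close>), and independence of the majorities in different
coordinates is an interchange of products (\<open>AE_cprob_profiles_indep\<close>). The statement with high
probability combines the Hoeffding estimate with a union bound.\<close>

section \<open>Deterministic motion of the centers\<close>

text \<open>Call \<open>max (\<bar>e k\<bar> - R k) 0\<close> with \<open>R k = \<beta> ^ k * r0\<close> the excess. A step in the right direction gives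
\<open>\<bar>e (k + 1)\<bar> \<le> max (\<bar>e k\<bar> - (1 - \<beta>) * R k) ((1 - \<beta>) * R k)\<close>. The first entry subtracts from \<open>\<bar>e k\<bar>\<close>
exactly what the radius loses, and the second, the overshoot, is at most \<open>\<beta> * R k\<close> because
\<open>\<beta> \<ge> 1 / 2\<close>; so the excess does not grow. A wrong step moves away by \<open>(1 - \<beta>) * R k\<close> while
the radius shrinks by the same amount, so the excess grows by at most \<open>2 * (1 - \<beta>) * R k\<close>.\<close>

lemma abs_error_le_sum_wrong:
  fixes e s :: "nat \<Rightarrow> real"
  assumes beta: "1 / 2 \<le> \<beta>" "\<beta> < 1" and r0: "0 < r0"
    and step: "\<And>k. e (Suc k) = e k - (1 - \<beta>) * (\<beta> ^ k * r0) * s k"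
    and sign: "\<And>k. s k \<in> {-1, 1}"
    and start: "\<bar>e 0\<bar> \<le> r0"
    and good: "\<And>k. k < K \<Longrightarrow> k \<notin> E \<Longrightarrow> e k \<noteq> 0 \<Longrightarrow> s k = sgn (e k)"
  shows "\<bar>e K\<bar> \<le> \<beta> ^ K * r0 + (\<Sum>k<K. 2 * (1 - \<beta>) * (\<beta> ^ k * r0) * indicator E k)"
  using good
proof (induction K)
  case 0
  then show ?case using start by simp
next
  case (Suc K)
  define R where "R = \<beta> ^ K * r0"
  define S where "S = (\<Sum>k<K. 2 * (1 - \<beta>) * (\<beta> ^ k * r0) * indicator E k)"
  have R: "0 < R" and S: "0 \<le> S"
    using beta r0 by (auto simp: R_def S_def intro!: sum_nonneg mult_nonneg_nonneg)
  have IH: "\<bar>e K\<bar> \<le> R + S"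
    using Suc by (simp add: R_def S_def)
  \<comment> \<open>The step length \<open>d\<close> is also the loss of radius: \<open>\<beta> * R = R - d\<close>.\<close>
  define d where "d = (1 - \<beta>) * R"
  have eS: "e (Suc K) = e K - d * s K"
    by (simp add: step R_def d_def)
  have d: "0 \<le> d" "d \<le> R - d"
    using beta R mult_right_mono[of "2 * (1 - \<beta>)" 1 R] by (auto simp: d_def)
  have "\<bar>e (Suc K)\<bar> \<le> (R - d) + (S + 2 * d * indicator E K)"
  proof (cases "K \<in> E")
    case True
    then show ?thesis using eS sign[of K] IH d by auto
  next
    case False
    then have "e K \<noteq> 0 \<Longrightarrow> s K = sgn (e K)" using Suc.prems by simp
    then show ?thesis
      using False eS sign[of K] IH d S
      by (cases "e K = 0") (auto simp: sgn_real_def split: if_splits)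
  qed
  then show ?case by (simp add: R_def S_def d_def algebra_simps)
qed

text \<open>The weights \<open>2 * (1 - \<beta>) * (\<beta> ^ k * r0)\<close> sum to \<open>2 * r0\<close> over all \<open>k\<close>. This is what keeps
the factor \<open>1 / (1 - \<beta>)\<close> out of the final bounds.\<close>

lemma weighted_error_sum_le:
  fixes \<beta> r0 q :: real
  assumes "0 \<le> \<beta>" "\<beta> < 1" "0 \<le> r0" "0 \<le> q" and P: "\<And>k. P k \<le> q"
  shows "(\<Sum>k<K. 2 * (1 - \<beta>) * (\<beta> ^ k * r0) * P k) \<le> 2 * r0 * q"
proof -
  have "(\<Sum>k<K. 2 * (1 - \<beta>) * (\<beta> ^ k * r0) * P k) \<le> (\<Sum>k<K. 2 * (1 - \<beta>) * (\<beta> ^ k * r0) * q)"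
    using assms by (intro sum_mono mult_left_mono) auto
  also have "\<dots> = 2 * r0 * q * ((1 - \<beta>) * (\<Sum>k<K. \<beta> ^ k))"
    by (simp add: sum_distrib_left algebra_simps)
  also have "(1 - \<beta>) * (\<Sum>k<K. \<beta> ^ k) = 1 - \<beta> ^ K"
    using assms by (simp add: sum_gp_strict)
  also have "2 * r0 * q * (1 - \<beta> ^ K) \<le> 2 * r0 * q * 1"
    using assms by (intro mult_left_mono) auto
  finally show ?thesis by simp
qed

lemma majority_sign: "majority m a $ i \<in> {-1, 1}"
  by (simp add: majority_def)

lemma center_increment_le:
  assumes "0 \<le> \<beta>" "\<beta> < 1" "0 < r0" "w $ i > 0"
  shows "\<bar>center \<beta> r0 w c0 m a (Suc k) $ i - center \<beta> r0 w c0 m a k $ i\<bar>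
    \<le> (1 - \<beta>) * r0 * w $ i * \<beta> ^ k"
  using assms majority_sign[of m "a k" i] by (auto simp: abs_mult)

text \<open>The steps made in coordinate \<open>i\<close> before step \<open>k\<close> have total length \<open>(1 - \<beta> ^ k) * (r0 * w $ i)\<close>. Hence
no sequence of answers, however wrong, leads out of the box on which the sign condition on \<open>f\<close> holds.\<close>

lemma center_in_box:
  assumes "0 \<le> \<beta>" "\<beta> < 1" "0 < r0" "\<forall>i. w $ i > 0"
  shows "center \<beta> r0 w c0 m a k \<in> coord_box c0 (r0 *\<^sub>R w)"
proof -
  have "\<bar>center \<beta> r0 w c0 m a k $ i - c0 $ i\<bar> \<le> (1 - \<beta> ^ k) * (r0 * w $ i)" for i
  proof (induction k)
    case (Suc k)
    show ?case
      using center_increment_le[of \<beta> r0 w i c0 m a k] assms Suc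
      by (simp del: center.simps add: algebra_simps)
  qed simp
  also have "(1 - \<beta> ^ k) * (r0 * w $ i) \<le> 1 * (r0 * w $ i)" for i
    using assms by (intro mult_right_mono) (auto simp: less_imp_le)
  finally show ?thesis by (simp add: coord_box_def)
qed

lemma convergent_center:
  assumes "0 \<le> \<beta>" "\<beta> < 1" "0 < r0" "w $ i > 0"
  shows "convergent (\<lambda>k. center \<beta> r0 w c0 m a k $ i)"
proof -
  let ?c = "\<lambda>k. center \<beta> r0 w c0 m a k $ i"
  have "summable (\<lambda>k. ?c (Suc k) - ?c k)"
  proof (rule summable_comparison_test')
    show "summable (\<lambda>k. (1 - \<beta>) * r0 * w $ i * \<beta> ^ k)"
      using assms by (intro summable_mult summable_geometric) auto
    show "norm (?c (Suc k) - ?c k) \<le> (1 - \<beta>) * r0 * w $ i * \<beta> ^ k" for k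
      using center_increment_le[OF assms, of c0 m a k] by (simp del: center.simps)
  qed
  then have "convergent (\<lambda>n. ?c n - ?c 0)"
    by (simp only: summable_iff_convergent sum_lessThan_telescope[of ?c])
  then have "convergent (\<lambda>n. (?c n - ?c 0) + ?c 0)"
    by (intro convergent_add convergent_const)
  then show ?thesis by simp
qed

lemma max_err_le_iff:
  "max_err w xs (x :: real ^ 'n) \<le> b \<longleftrightarrow> (\<forall>i. \<bar>x $ i - xs $ i\<bar> / w $ i \<le> b)"
  by (auto simp: max_err_def)

lemma tendsto_Max_range:
  fixes u :: "'b \<Rightarrow> 'n :: finite \<Rightarrow> real"
  assumes "\<And>i. ((\<lambda>k. u k i) \<longlongrightarrow> L i) F"
  shows "((\<lambda>k. Max (range (u k))) \<longlongrightarrow> Max (range L)) F"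
proof -
  have "((\<lambda>k. Max (u k ` I)) \<longlongrightarrow> Max (L ` I)) F" if "finite I" "I \<noteq> {}" for I :: "'n set"
    using that
  proof (induction I rule: finite_ne_induct)
    case (singleton i)
    then show ?case using assms by simp
  next
    case (insert i I)
    then have "((\<lambda>k. max (u k i) (Max (u k ` I))) \<longlongrightarrow> max (L i) (Max (L ` I))) F"
      by (intro tendsto_max assms)
    with insert show ?case by simp
  qed
  then show ?thesis by simp
qed

lemma sign_from_class_U:
  assumes "f \<in> class_U xs B" "x \<in> B" "x $ i \<noteq> xs $ i"
  shows "sgn (pderiv_at i f x) = sgn (x $ i - xs $ i)" "pderiv_at i f x \<noteq> 0"
proof -
  have "pderiv_at i f x * (x $ i - xs $ i) > 0"
    using assms by (auto simp: class_U_def)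
  then show "sgn (pderiv_at i f x) = sgn (x $ i - xs $ i)" "pderiv_at i f x \<noteq> 0"
    by (auto simp: zero_less_mult_iff)
qed


section \<open>A tail bound for majorities\<close>

text \<open>The tie-breaking value \<open>-1\<close> has to be the one used by \<^const>\<open>majority\<close>.\<close>

definition vote :: "nat \<Rightarrow> (nat \<Rightarrow> real) \<Rightarrow> real" where
  "vote m h = (if card {j. j < m \<and> h j = -1} < card {j. j < m \<and> h j = 1} then 1 else -1)"

text \<open>\<open>q / a + (1 - q) * a\<close> is the expectation of \<open>a powr (- X)\<close> for a sign \<open>X\<close> that is \<open>1\<close> with
probability \<open>q\<close>; it decreases in \<open>q\<close> when \<open>a \<ge> 1\<close>. The optimal choice
\<open>a\<^sup>2 = (1 / 2 + \<gamma>) / (1 / 2 - \<gamma>)\<close> turns its value at \<open>q = 1 / 2 + \<gamma>\<close> into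
\<open>sqrt (1 - 4 * \<gamma>\<^sup>2)\<close>, and \<open>1 + x \<le> exp x\<close> finishes. One \<open>a\<close> has to serve all \<open>q\<close>, since
the queries of a round may have different success probabilities.\<close>

lemma chernoff_factor:
  assumes "0 < \<gamma>"
  obtains a :: real where "1 \<le> a"
    "\<And>q. 1 / 2 + \<gamma> \<le> q \<Longrightarrow> q \<le> 1 \<Longrightarrow> q / a + (1 - q) * a \<le> exp (- 2 * \<gamma>\<^sup>2)"
proof (cases "\<gamma> < 1 / 2")
  case True
  define u v a where "u = sqrt (1 / 2 + \<gamma>)" and "v = sqrt (1 / 2 - \<gamma>)" and "a = u / v"
  have uv: "u\<^sup>2 = 1 / 2 + \<gamma>" "v\<^sup>2 = 1 / 2 - \<gamma>" "0 < v" "v \<le> u"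
    using assms True by (auto simp: u_def v_def)
  have a: "1 \<le> a" using uv by (simp add: a_def)
  have "q / a + (1 - q) * a \<le> exp (- 2 * \<gamma>\<^sup>2)" if q: "1 / 2 + \<gamma> \<le> q" "q \<le> 1" for q
  proof -
    have "1 / a \<le> 1" using a by simp
    then have a': "1 / a \<le> a" using a by linarith
    have "q / a + (1 - q) * a = a - q * (a - 1 / a)" by (simp add: algebra_simps)
    also have "\<dots> \<le> a - (1 / 2 + \<gamma>) * (a - 1 / a)"
      using q a' by (intro diff_left_mono mult_right_mono) auto
    also have "\<dots> = (1 / 2 + \<gamma>) / a + (1 / 2 - \<gamma>) * a" using a by (simp add: field_simps)
    also have "\<dots> = u\<^sup>2 / a + v\<^sup>2 * a"
      by (simp only: uv(1,2))
    also have "\<dots> = 2 * (u * v)"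
      using uv(3,4) by (simp add: a_def power2_eq_square)
    also have "\<dots> = sqrt (1 - 4 * \<gamma>\<^sup>2)"
    proof (rule real_sqrt_unique[symmetric])
      have "(2 * (u * v))\<^sup>2 = 4 * (u\<^sup>2 * v\<^sup>2)"
        by (simp add: power_mult_distrib)
      also have "\<dots> = 4 * ((1 / 2 + \<gamma>) * (1 / 2 - \<gamma>))"
        by (simp only: uv(1,2))
      also have "\<dots> = 1 - 4 * \<gamma>\<^sup>2"
        by (simp add: power2_eq_square algebra_simps)
      finally show "(2 * (u * v))\<^sup>2 = 1 - 4 * \<gamma>\<^sup>2" .
      show "0 \<le> 2 * (u * v)" using uv(3,4) by simp
    qed
    also have "\<dots> \<le> sqrt ((exp (- 2 * \<gamma>\<^sup>2))\<^sup>2)"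
      using exp_ge_add_one_self[of "- 4 * \<gamma>\<^sup>2"]
      by (intro real_sqrt_le_mono) (simp add: power2_eq_square mult_exp_exp)
    finally show ?thesis by simp
  qed
  with a that show ?thesis by blast
next
  case False
  have "q / exp (1 / 2) + (1 - q) * exp (1 / 2) \<le> exp (- 2 * \<gamma>\<^sup>2)"
    if "1 / 2 + \<gamma> \<le> q" "q \<le> 1" for q :: real
  proof -
    \<comment> \<open>The optimal \<open>a\<close> is infinite here, but the answers are then always right and \<open>exp (1 / 2)\<close> suffices.\<close>
    have "q = 1" "\<gamma> = 1 / 2" using that False by auto
    then show ?thesis by (simp add: exp_minus power2_eq_square field_simps)
  qed
  then show ?thesis using that[of "exp (1 / 2)"] by simp
qed

text \<open>Chernoff bound for the weights of a product measure on \<open>{-1, 1}\<close>-valued tuples. If \<open>s\<close> loses the vote, at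
least half of the entries differ from \<open>s\<close>, so the product of the factors \<open>1 / a\<close> (for an entry
\<open>s\<close>) and \<open>a\<close> (for any other entry) is at least \<open>1\<close>. Inserting these factors, dropping the
restriction to losing tuples and interchanging sum and product leaves one factor per query.\<close>

lemma vote_tail:
  fixes q :: "nat \<Rightarrow> real \<Rightarrow> real"
  assumes s: "s \<in> {-1, 1}" and gamma: "0 < \<gamma>"
    and nonneg: "\<And>j x. j < m \<Longrightarrow> 0 \<le> q j x"
    and total: "\<And>j. j < m \<Longrightarrow> q j s + q j (- s) = 1"
    and bias: "\<And>j. j < m \<Longrightarrow> 1 / 2 + \<gamma> \<le> q j s"
  shows "(\<Sum>h\<in>{h \<in> {..<m} \<rightarrow>\<^sub>E {-1, 1}. vote m h \<noteq> s}. \<Prod>j<m. q j (h j))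
    \<le> exp (- 2 * \<gamma>\<^sup>2 * real m)"
proof -
  obtain a :: real where a: "1 \<le> a"
    and aq: "\<And>q. 1 / 2 + \<gamma> \<le> q \<Longrightarrow> q \<le> 1 \<Longrightarrow> q / a + (1 - q) * a \<le> exp (- 2 * \<gamma>\<^sup>2)"
    using chernoff_factor[OF gamma] by blast
  define t where "t x = (if x = s then 1 / a else a)" for x
  have t: "0 \<le> t x" for x using a by (simp add: t_def)
  have ss: "s \<noteq> - s" using s by auto
  have weight: "1 \<le> (\<Prod>j<m. t (h j))" if h: "h \<in> {..<m} \<rightarrow>\<^sub>E {-1, 1}" "vote m h \<noteq> s" for h
  proof -
    let ?S = "{j. j < m \<and> h j = s}" and ?N = "{j. j < m \<and> h j = - s}"
    have "card ?S \<le> card ?N"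
      using h(2) s by (auto simp: vote_def split: if_splits)
    have un: "{..<m} = ?S \<union> ?N" "?S \<inter> ?N = {}"
      using h(1) s ss by (auto simp: PiE_iff)
    have "(\<Prod>j<m. t (h j)) = (\<Prod>j\<in>?S. t (h j)) * (\<Prod>j\<in>?N. t (h j))"
      unfolding un(1) by (rule prod.union_disjoint) (use un in auto)
    also have "(\<Prod>j\<in>?S. t (h j)) = (1 / a) ^ card ?S"
      by (simp add: t_def)
    also have "(\<Prod>j\<in>?N. t (h j)) = a ^ card ?N"
      using ss by (simp add: t_def)
    also have "(1 / a) ^ card ?S * a ^ card ?N = a ^ card ?N / a ^ card ?S"
      by (simp add: power_divide)
    also have "\<dots> \<ge> 1"
      using a \<open>card ?S \<le> card ?N\<close> by (simp add: power_increasing)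
    finally show ?thesis .
  qed
  have "(\<Sum>h\<in>{h \<in> {..<m} \<rightarrow>\<^sub>E {-1, 1}. vote m h \<noteq> s}. \<Prod>j<m. q j (h j))
      \<le> (\<Sum>h\<in>{h \<in> {..<m} \<rightarrow>\<^sub>E {-1, 1}. vote m h \<noteq> s}. \<Prod>j<m. q j (h j) * t (h j))"
  proof (rule sum_mono)
    fix h assume h: "h \<in> {h \<in> {..<m} \<rightarrow>\<^sub>E {-1, 1}. vote m h \<noteq> s}"
    have "(\<Prod>j<m. q j (h j)) * 1 \<le> (\<Prod>j<m. q j (h j)) * (\<Prod>j<m. t (h j))"
      using h nonneg by (intro mult_left_mono weight prod_nonneg) auto
    then show "(\<Prod>j<m. q j (h j)) \<le> (\<Prod>j<m. q j (h j) * t (h j))"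
      by (simp add: prod.distrib)
  qed
  also have "\<dots> \<le> (\<Sum>h\<in>{..<m} \<rightarrow>\<^sub>E {-1, 1}. \<Prod>j<m. q j (h j) * t (h j))"
    using nonneg t by (intro sum_mono2 finite_PiE prod_nonneg) auto
  also have "\<dots> = (\<Prod>j<m. \<Sum>x\<in>{-1, 1}. q j x * t x)"
    by (rule prod_sum_PiE[symmetric]) auto
  also have "\<dots> \<le> (\<Prod>j<m. exp (- 2 * \<gamma>\<^sup>2))"
  proof (rule prod_mono)
    fix j assume "j \<in> {..<m}"
    then have j: "j < m" by simp
    have "{-1, 1} = {s, - s}" using s by auto
    then have "(\<Sum>x\<in>{-1, 1}. q j x * t x) = q j s / a + (1 - q j s) * a"
      using ss total[OF j] by (simp add: t_def)
    also have "\<dots> \<le> exp (- 2 * \<gamma>\<^sup>2)"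
      using aq[OF bias[OF j]] total[OF j] nonneg[OF j, of "- s"] by simp
    finally have "(\<Sum>x\<in>{-1, 1}. q j x * t x) \<le> exp (- 2 * \<gamma>\<^sup>2)" .
    moreover have "0 \<le> (\<Sum>x\<in>{-1, 1}. q j x * t x)"
      using nonneg[OF j] t by (intro sum_nonneg mult_nonneg_nonneg) auto
    ultimately show "0 \<le> (\<Sum>x\<in>{-1, 1}. q j x * t x) \<and>
      (\<Sum>x\<in>{-1, 1}. q j x * t x) \<le> exp (- 2 * \<gamma>\<^sup>2)" by blast
  qed
  also have "\<dots> = exp (- 2 * \<gamma>\<^sup>2 * real m)"
    by (simp add: exp_of_nat_mult[symmetric] mult_ac)
  finally show ?thesis .
qed

section \<open>Conditional probabilities\<close>

context prob_space
begin

lemma prob_space_subalgebra: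
  assumes "subalgebra M G"
  shows "finite_measure_subalgebra M G"
  by standard fact

lemma integrable_indicator_event: "A \<in> events \<Longrightarrow> integrable M (indicator A :: 'a \<Rightarrow> real)"
  by (rule integrable_const_bound[of _ 1]) (auto simp: indicator_def)

lemma cprob_nonneg:
  assumes G: "subalgebra M G" and P: "{\<omega> \<in> space M. P \<omega>} \<in> sets M"
  shows "AE \<omega> in M. 0 \<le> cprob M G P \<omega>"
proof -
  interpret F: finite_measure_subalgebra M G by (rule prob_space_subalgebra[OF G])
  show ?thesis unfolding cprob_def using P by (intro F.real_cond_exp_pos) auto
qed

text \<open>Locality: \<open>indicator T\<close> is measurable with respect to \<open>G\<close> and can be taken out of the conditional
expectation.\<close>

lemma cprob_cong_on:
  assumes G: "subalgebra M G" and T: "T \<in> sets G"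
    and P: "{\<omega> \<in> space M. P \<omega>} \<in> sets M" and Q: "{\<omega> \<in> space M. Q \<omega>} \<in> sets M"
    and eq: "\<And>\<omega>. \<omega> \<in> T \<Longrightarrow> P \<omega> \<longleftrightarrow> Q \<omega>"
  shows "AE \<omega> in M. \<omega> \<in> T \<longrightarrow> cprob M G P \<omega> = cprob M G Q \<omega>"
proof -
  interpret F: finite_measure_subalgebra M G by (rule prob_space_subalgebra[OF G])
  have TM: "T \<in> sets M" using G T by (auto simp: subalgebra_def)
  let ?I = "\<lambda>P. indicator {\<omega> \<in> space M. P \<omega>} :: 'a \<Rightarrow> real"
  have mult: "AE \<omega> in M. real_cond_exp M G (\<lambda>\<omega>. indicator T \<omega> * ?I R \<omega>) \<omega>
      = indicator T \<omega> * real_cond_exp M G (?I R) \<omega>" if R: "{\<omega> \<in> space M. R \<omega>} \<in> sets M" for R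
    using T TM R
    by (intro F.real_cond_exp_mult)
       (auto simp: indicator_inter_arith[symmetric] intro!: integrable_indicator_event)
  have same: "(\<lambda>\<omega>. indicator T \<omega> * ?I P \<omega>) = (\<lambda>\<omega>. indicator T \<omega> * ?I Q \<omega>)"
    using eq by (auto simp: fun_eq_iff indicator_def)
  show ?thesis
    using mult[OF P, unfolded same] mult[OF Q] unfolding cprob_def by eventually_elim (auto simp: indicator_def)
qed

text \<open>A random parameter that is known given \<open>G\<close> may be treated as a constant. Since \<open>C\<close> takes finitely many
values, this can be checked value by value: on each of the sets \<open>{C = v}\<close> the two events
agree, and locality applies. The inner \<open>C \<omega>\<close> on the right-hand side is evaluated outside the
conditional probability.\<close>

lemma cprob_freeze:
  assumes G: "subalgebra M G" and fin: "finite (C ` space M)"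
    and C: "\<And>v. {\<omega> \<in> space M. C \<omega> = v} \<in> sets G"
    and P: "\<And>v. {\<omega> \<in> space M. P v \<omega>} \<in> sets M"
  shows "{\<omega> \<in> space M. P (C \<omega>) \<omega>} \<in> sets M"
    and "AE \<omega> in M. cprob M G (\<lambda>\<omega>'. P (C \<omega>') \<omega>') \<omega> = cprob M G (P (C \<omega>)) \<omega>"
proof -
  have CM: "{\<omega> \<in> space M. C \<omega> = v} \<in> sets M" for v
    using C G by (auto simp: subalgebra_def)
  have "{\<omega> \<in> space M. P (C \<omega>) \<omega>}
      = (\<Union>v\<in>C ` space M. {\<omega> \<in> space M. C \<omega> = v} \<inter> {\<omega> \<in> space M. P v \<omega>})" by auto
  also have "\<dots> \<in> sets M" using fin CM P by (intro sets.finite_UN sets.Int) auto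
  finally show PC: "{\<omega> \<in> space M. P (C \<omega>) \<omega>} \<in> sets M" .
  have "AE \<omega> in M. \<forall>v\<in>C ` space M. \<omega> \<in> {\<omega> \<in> space M. C \<omega> = v} \<longrightarrow>
      cprob M G (\<lambda>\<omega>'. P (C \<omega>') \<omega>') \<omega> = cprob M G (P v) \<omega>"
    using PC P by (intro AE_finite_allI fin cprob_cong_on[OF G C]) auto
  with AE_space show "AE \<omega> in M. cprob M G (\<lambda>\<omega>'. P (C \<omega>') \<omega>') \<omega> = cprob M G (P (C \<omega>)) \<omega>"
    by eventually_elim auto
qed

lemma cprob_range_sum:
  assumes G: "subalgebra M G" and fin: "finite B"
    and X: "\<And>b. {\<omega> \<in> space M. X \<omega> = b} \<in> sets M"
  shows "AE \<omega> in M. cprob M G (\<lambda>\<omega>. X \<omega> \<in> B) \<omega> = (\<Sum>b\<in>B. cprob M G (\<lambda>\<omega>. X \<omega> = b) \<omega>)"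
proof -
  interpret F: finite_measure_subalgebra M G by (rule prob_space_subalgebra[OF G])
  have split: "(indicator {\<omega> \<in> space M. X \<omega> \<in> B} :: 'a \<Rightarrow> real)
      = (\<lambda>\<omega>. \<Sum>b\<in>B. indicator {\<omega> \<in> space M. X \<omega> = b} \<omega>)"
    using fin by (auto simp: fun_eq_iff indicator_def)
  show ?thesis
    unfolding cprob_def split
    by (rule F.real_cond_exp_sum) (rule integrable_indicator_event[OF X])
qed

lemma cprob_space:
  assumes G: "subalgebra M G" and P: "\<And>\<omega>. \<omega> \<in> space M \<Longrightarrow> P \<omega>"
  shows "AE \<omega> in M. cprob M G P \<omega> = 1"
proof -
  interpret F: finite_measure_subalgebra M G by (rule prob_space_subalgebra[OF G])
  have whole: "{\<omega> \<in> space M. P \<omega>} = space M" using P by auto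
  have "AE \<omega> in M. real_cond_exp M G (\<lambda>_. 1 :: real) \<omega> = 1" by (rule F.real_cond_exp_F_meas) auto
  moreover have "AE \<omega> in M. cprob M G P \<omega> = real_cond_exp M G (\<lambda>_. 1 :: real) \<omega>"
    unfolding cprob_def
    by (rule F.real_cond_exp_cong) (auto intro!: AE_I2 simp: whole)
  ultimately show ?thesis by eventually_elim simp
qed

lemma cprob_not:
  assumes G: "subalgebra M G" and P: "{\<omega> \<in> space M. P \<omega>} \<in> sets M"
  shows "AE \<omega> in M. cprob M G (\<lambda>\<omega>. \<not> P \<omega>) \<omega> = 1 - cprob M G P \<omega>"
proof -
  have meas: "{\<omega> \<in> space M. P \<omega> = b} \<in> sets M" for b
    by (cases b) (use P sets.sets_Collect_neg in auto)
  have "AE \<omega> in M. cprob M G (\<lambda>\<omega>. P \<omega> \<in> {True, False}) \<omega> = 1"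
    by (rule cprob_space[OF G]) auto
  with cprob_range_sum[where X = P, OF G _ meas, of "{True, False}", simplified]
  show ?thesis by eventually_elim simp
qed

lemma expectation_cprob:
  assumes G: "subalgebra M G" and P: "{\<omega> \<in> space M. P \<omega>} \<in> sets M"
  shows "integrable M (cprob M G P)" "expectation (cprob M G P) = prob {\<omega> \<in> space M. P \<omega>}"
proof -
  interpret F: finite_measure_subalgebra M G by (rule prob_space_subalgebra[OF G])
  have "integrable M (indicator {\<omega> \<in> space M. P \<omega>} :: 'a \<Rightarrow> real)"
    using P by (rule integrable_indicator_event)
  from F.real_cond_exp_int[OF this] P
  show "integrable M (cprob M G P)" "expectation (cprob M G P) = prob {\<omega> \<in> space M. P \<omega>}"
    by (simp_all add: cprob_def)
qed

lemma prob_le_of_cprob_le: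
  assumes "subalgebra M G" "{\<omega> \<in> space M. P \<omega>} \<in> sets M" "AE \<omega> in M. cprob M G P \<omega> \<le> p"
  shows "prob {\<omega> \<in> space M. P \<omega>} \<le> p"
  using integral_mono_AE[of M "cprob M G P" "\<lambda>_. p"] assms expectation_cprob[OF assms(1,2)]
  by (simp add: prob_space)

lemma prob_ge_of_cprob_ge:
  assumes "subalgebra M G" "{\<omega> \<in> space M. P \<omega>} \<in> sets M" "AE \<omega> in M. p \<le> cprob M G P \<omega>"
  shows "p \<le> prob {\<omega> \<in> space M. P \<omega>}"
  using integral_mono_AE[of M "\<lambda>_. p" "cprob M G P"] assms expectation_cprob[OF assms(1,2)]
  by (simp add: prob_space)

end

section \<open>One round of queries\<close>

text \<open>The profile is restricted to \<open>{..<m}\<close> so that it ranges over a finite set of functions.\<close>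

definition profile :: "nat \<Rightarrow> (nat \<Rightarrow> 'a \<Rightarrow> real ^ 'n) \<Rightarrow> 'n \<Rightarrow> 'a \<Rightarrow> nat \<Rightarrow> real" where
  "profile m X i \<omega> = restrict (\<lambda>j. X j \<omega> $ i) {..<m}"

lemma majority_profile: "majority m (\<lambda>j. X j \<omega>) $ i = vote m (profile m X i \<omega>)"
  by (simp add: majority_def vote_def profile_def cong: conj_cong)

lemma restrict_eq_iff: "restrict f A = h \<longleftrightarrow> h \<in> extensional A \<and> (\<forall>j\<in>A. f j = h j)"
  by (auto simp: extensional_def fun_eq_iff)

lemma profile_in_signs:
  assumes "\<And>j i. j < m \<Longrightarrow> X j \<omega> $ i \<in> {-1, 1}"
  shows "profile m X i \<omega> \<in> {..<m} \<rightarrow>\<^sub>E {-1, 1}"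
  using assms by (auto simp: profile_def PiE_iff)

lemma finite_profiles: "finite ({..<m :: nat} \<rightarrow>\<^sub>E {-1, 1 :: real})"
  by (intro finite_PiE) auto

lemma sets_profile_eq:
  assumes "\<And>j. j < m \<Longrightarrow> X j \<in> borel_measurable N"
  shows "{\<omega> \<in> space N. profile m X i \<omega> = h} \<in> sets N"
proof -
  have "{\<omega> \<in> space N. X j \<omega> $ i = h j} \<in> sets N" if "j < m" for j
    using assms[OF that] by measurable
  then have "{\<omega> \<in> space N. \<forall>j\<in>{..<m}. X j \<omega> $ i = h j} \<in> sets N"
    by (intro sets.sets_Collect_finite_All) auto
  then show ?thesis
    by (cases "h \<in> extensional {..<m}") (auto simp: profile_def restrict_eq_iff)
qed

lemma sets_profile_pred:
  assumes "\<And>j. j < m \<Longrightarrow> X j \<in> borel_measurable N"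
    and "\<And>j \<omega> i. j < m \<Longrightarrow> \<omega> \<in> space N \<Longrightarrow> X j \<omega> $ i \<in> {-1, 1}"
  shows "{\<omega> \<in> space N. Q (profile m X i \<omega>)} \<in> sets N"
proof -
  have "{\<omega> \<in> space N. Q (profile m X i \<omega>)}
    = (\<Union>h\<in>{h \<in> {..<m} \<rightarrow>\<^sub>E {-1, 1}. Q h}. {\<omega> \<in> space N. profile m X i \<omega> = h})"
    using profile_in_signs[of m X _ i] assms(2) by auto
  also have "\<dots> \<in> sets N"
    using finite_profiles sets_profile_eq[OF assms(1)] by (intro sets.finite_UN) auto
  finally show ?thesis .
qed

locale query_round = prob_space M for M :: "'a measure" +
  fixes G :: "'a measure" and m :: nat and X :: "nat \<Rightarrow> 'a \<Rightarrow> real ^ 'n"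
  assumes G: "subalgebra M G"
    and X_meas: "\<And>j. j < m \<Longrightarrow> X j \<in> borel_measurable M"
    and X_sign: "\<And>j \<omega> i. j < m \<Longrightarrow> \<omega> \<in> space M \<Longrightarrow> X j \<omega> $ i \<in> {-1, 1}"
    and X_indep: "cond_indep_family M G borel {..<m} X"
begin

lemma answer_meas: "j < m \<Longrightarrow> {\<omega> \<in> space M. X j \<omega> $ i = x} \<in> sets M"
  using X_meas[of j] by measurable

lemmas profile_meas = sets_profile_eq[OF X_meas]

lemma profile_sign:
  "\<omega> \<in> space M \<Longrightarrow> profile m X i \<omega> \<in> {..<m} \<rightarrow>\<^sub>E {-1, 1}"
  using X_sign by (intro profile_in_signs)

lemma profile_pred_meas: "{\<omega> \<in> space M. Q (profile m X i \<omega>)} \<in> sets M"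
  by (rule sets_profile_pred[OF X_meas X_sign])

lemma AE_cprob_profile_eq:
  "AE \<omega> in M. \<forall>h\<in>{..<m} \<rightarrow>\<^sub>E {-1, 1}. cprob M G (\<lambda>\<omega>'. profile m X i \<omega>' = h) \<omega>
     = (\<Prod>j<m. cprob M G (\<lambda>\<omega>'. X j \<omega>' $ i = h j) \<omega>)"
proof (intro AE_finite_allI finite_profiles)
  fix h :: "nat \<Rightarrow> real" assume h: "h \<in> {..<m} \<rightarrow>\<^sub>E {-1, 1}"
  have "{x :: real ^ 'n. x $ i = y} \<in> sets borel" for y by measurable
  with X_indep[unfolded cond_indep_family_def, rule_format, of "\<lambda>j. {x. x $ i = h j}"]
  have "AE \<omega> in M. cprob M G (\<lambda>\<omega>'. \<forall>j\<in>{..<m}. X j \<omega>' \<in> {x. x $ i = h j}) \<omega>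
      = (\<Prod>j<m. cprob M G (\<lambda>\<omega>'. X j \<omega>' \<in> {x. x $ i = h j}) \<omega>)"
    by simp
  moreover have "(\<lambda>\<omega>'. \<forall>j\<in>{..<m}. X j \<omega>' \<in> {x. x $ i = h j}) = (\<lambda>\<omega>'. profile m X i \<omega>' = h)"
    using h by (auto simp: profile_def restrict_eq_iff PiE_iff)
  ultimately show "AE \<omega> in M. cprob M G (\<lambda>\<omega>'. profile m X i \<omega>' = h) \<omega>
     = (\<Prod>j<m. cprob M G (\<lambda>\<omega>'. X j \<omega>' $ i = h j) \<omega>)" by simp
qed

text \<open>The conditional law of the answers in one coordinate is almost surely the product of the laws of the
single answers. After this, bounds on conditional probabilities reduce, for almost every fixed outcome,
to inequalities between finite sums.\<close>

lemma AE_cprob_profile_pred: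
  "AE \<omega> in M. cprob M G (\<lambda>\<omega>'. Q (profile m X i \<omega>')) \<omega>
     = (\<Sum>h\<in>{h \<in> {..<m} \<rightarrow>\<^sub>E {-1, 1}. Q h}. \<Prod>j<m. cprob M G (\<lambda>\<omega>'. X j \<omega>' $ i = h j) \<omega>)"
proof -
  let ?B = "{h \<in> {..<m} \<rightarrow>\<^sub>E {-1, 1 :: real}. Q h}"
  have sum: "AE \<omega> in M. cprob M G (\<lambda>\<omega>'. profile m X i \<omega>' \<in> ?B) \<omega>
      = (\<Sum>h\<in>?B. cprob M G (\<lambda>\<omega>'. profile m X i \<omega>' = h) \<omega>)"
    using finite_profiles by (intro cprob_range_sum[OF G _ profile_meas]) auto
  have "{\<omega> \<in> space M. profile m X i \<omega> \<in> ?B} = {\<omega> \<in> space M. Q (profile m X i \<omega>)}"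
    using profile_sign by auto
  then have eq: "cprob M G (\<lambda>\<omega>'. profile m X i \<omega>' \<in> ?B) = cprob M G (\<lambda>\<omega>'. Q (profile m X i \<omega>'))"
    unfolding cprob_def by simp
  show ?thesis
    using sum[unfolded eq] AE_cprob_profile_eq[of i] by eventually_elim simp
qed

lemma AE_vote_tail:
  assumes gamma: "0 < \<gamma>"
  shows "AE \<omega> in M. \<forall>s\<in>{-1, 1}. (\<forall>j<m. 1 / 2 + \<gamma> \<le> cprob M G (\<lambda>\<omega>'. X j \<omega>' $ i = s) \<omega>) \<longrightarrow>
     cprob M G (\<lambda>\<omega>'. vote m (profile m X i \<omega>') \<noteq> s) \<omega> \<le> exp (- 2 * \<gamma>\<^sup>2 * real m)"
proof (rule AE_finite_allI)
  fix s :: real assume s: "s \<in> {-1, 1}"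
  let ?q = "\<lambda>\<omega> j x. cprob M G (\<lambda>\<omega>'. X j \<omega>' $ i = x) \<omega>"
  have nonneg: "AE \<omega> in M. \<forall>j\<in>{..<m}. \<forall>x\<in>{-1, 1}. 0 \<le> ?q \<omega> j x"
    by (intro AE_finite_allI cprob_nonneg[OF G] answer_meas) auto
  have total: "AE \<omega> in M. \<forall>j\<in>{..<m}. ?q \<omega> j s + ?q \<omega> j (- s) = 1"
  proof (rule AE_finite_allI)
    fix j assume "j \<in> {..<m}"
    then have j: "j < m" by simp
    have "{\<omega> \<in> space M. X j \<omega> $ i = - s} = {\<omega> \<in> space M. X j \<omega> $ i \<noteq> s}"
      using X_sign[OF j, of _ i] s by force
    then have neg: "cprob M G (\<lambda>\<omega>'. X j \<omega>' $ i = - s) = cprob M G (\<lambda>\<omega>'. \<not> X j \<omega>' $ i = s)"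
      unfolding cprob_def by simp
    show "AE \<omega> in M. ?q \<omega> j s + ?q \<omega> j (- s) = 1"
      using cprob_not[OF G answer_meas[OF j, of i s]] unfolding neg by eventually_elim simp
  qed simp
  show "AE \<omega> in M. (\<forall>j<m. 1 / 2 + \<gamma> \<le> ?q \<omega> j s) \<longrightarrow>
     cprob M G (\<lambda>\<omega>'. vote m (profile m X i \<omega>') \<noteq> s) \<omega> \<le> exp (- 2 * \<gamma>\<^sup>2 * real m)"
    using nonneg total AE_cprob_profile_pred[of "\<lambda>h. vote m h \<noteq> s" i]
  proof eventually_elim
    case (elim \<omega>)
    show ?case
    proof
      assume bias: "\<forall>j<m. 1 / 2 + \<gamma> \<le> ?q \<omega> j s"
      \<comment> \<open>The conditional probability of an answer \<open>x\<close> is known to be nonnegative at \<open>\<omega>\<close> only for \<open>x \<in> {-1, 1}\<close>.\<close>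
      define q where "q j x = max 0 (?q \<omega> j x)" for j x
      have q: "q j x = ?q \<omega> j x" if "j < m" "x \<in> {-1, 1}" for j x
        using elim(1) that by (auto simp: q_def)
      have "(\<Sum>h\<in>{h \<in> {..<m} \<rightarrow>\<^sub>E {-1, 1}. vote m h \<noteq> s}. \<Prod>j<m. q j (h j))
          \<le> exp (- 2 * \<gamma>\<^sup>2 * real m)"
        using s bias elim q by (intro vote_tail gamma) (auto simp: q_def)
      also have "(\<Sum>h\<in>{h \<in> {..<m} \<rightarrow>\<^sub>E {-1, 1}. vote m h \<noteq> s}. \<Prod>j<m. q j (h j))
          = cprob M G (\<lambda>\<omega>'. vote m (profile m X i \<omega>') \<noteq> s) \<omega>"
        unfolding elim(3) by (intro sum.cong prod.cong q) (auto simp: PiE_iff)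
      finally show "cprob M G (\<lambda>\<omega>'. vote m (profile m X i \<omega>') \<noteq> s) \<omega> \<le> exp (- 2 * \<gamma>\<^sup>2 * real m)" .
    qed
  qed
qed simp

text \<open>Independence across queries, and across coordinates within each query, makes the whole table of answers
conditionally independent. Regrouping the product over the table by coordinates instead of queries
shows that events which each concern a single coordinate are independent, majorities included.\<close>

lemma AE_cprob_profiles_indep:
  assumes coords: "\<And>j. j < m \<Longrightarrow> cond_indep_family M G borel UNIV (\<lambda>i \<omega>. X j \<omega> $ i)"
  shows "AE \<omega> in M. cprob M G (\<lambda>\<omega>'. \<forall>i. Q i (profile m X i \<omega>')) \<omega>
     = (\<Prod>i\<in>UNIV. cprob M G (\<lambda>\<omega>'. Q i (profile m X i \<omega>')) \<omega>)"
proof -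
  let ?q = "\<lambda>\<omega> j i x. cprob M G (\<lambda>\<omega>'. X j \<omega>' $ i = x) \<omega>"
  define A where "A i = {h \<in> {..<m} \<rightarrow>\<^sub>E {-1, 1 :: real}. Q i h}" for i
  have finA: "finite (A i)" for i using finite_profiles by (simp add: A_def)
  let ?T = "PiE UNIV A"
  have finT: "finite ?T" using finA by (intro finite_PiE) auto
  have joint: "AE \<omega> in M. \<forall>g\<in>?T. cprob M G (\<lambda>\<omega>'. (\<lambda>i. profile m X i \<omega>') = g) \<omega>
      = (\<Prod>i\<in>UNIV. \<Prod>j<m. ?q \<omega> j i (g i j))"
  proof (intro AE_finite_allI finT)
    fix g assume g: "g \<in> ?T"
    have "{x :: real ^ 'n. \<forall>i. x $ i = y i} \<in> sets borel" for y by measurable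
    with X_indep[unfolded cond_indep_family_def, rule_format,
        of "\<lambda>j. {x. \<forall>i. x $ i = g i j}"]
    have rounds: "AE \<omega> in M.
        cprob M G (\<lambda>\<omega>'. \<forall>j\<in>{..<m}. X j \<omega>' \<in> {x. \<forall>i. x $ i = g i j}) \<omega>
        = (\<Prod>j<m. cprob M G (\<lambda>\<omega>'. X j \<omega>' \<in> {x. \<forall>i. x $ i = g i j}) \<omega>)"
      by simp
    have eq: "(\<lambda>\<omega>'. \<forall>j\<in>{..<m}. X j \<omega>' \<in> {x. \<forall>i. x $ i = g i j})
        = (\<lambda>\<omega>'. (\<lambda>i. profile m X i \<omega>') = g)"
      using g by (auto simp: profile_def restrict_eq_iff PiE_iff A_def fun_eq_iff[of _ g])
    have "AE \<omega> in M. \<forall>j\<in>{..<m}.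
        cprob M G (\<lambda>\<omega>'. X j \<omega>' \<in> {x. \<forall>i. x $ i = g i j}) \<omega> = (\<Prod>i\<in>UNIV. ?q \<omega> j i (g i j))"
    proof (rule AE_finite_allI)
      fix j assume "j \<in> {..<m}"
      then have "cond_indep_family M G borel UNIV (\<lambda>i \<omega>. X j \<omega> $ i)" by (intro coords) auto
      then have "AE \<omega> in M. cprob M G (\<lambda>\<omega>'. \<forall>i\<in>UNIV. X j \<omega>' $ i \<in> {g i j}) \<omega>
          = (\<Prod>i\<in>UNIV. cprob M G (\<lambda>\<omega>'. X j \<omega>' $ i \<in> {g i j}) \<omega>)"
        unfolding cond_indep_family_def
        by (elim allE[of _ "\<lambda>i. {g i j}"] impE) auto
      then show "AE \<omega> in M. cprob M G (\<lambda>\<omega>'. X j \<omega>' \<in> {x. \<forall>i. x $ i = g i j}) \<omega>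
          = (\<Prod>i\<in>UNIV. ?q \<omega> j i (g i j))" by simp
    qed simp
    with rounds[unfolded eq] show "AE \<omega> in M. cprob M G (\<lambda>\<omega>'. (\<lambda>i. profile m X i \<omega>') = g) \<omega>
      = (\<Prod>i\<in>UNIV. \<Prod>j<m. ?q \<omega> j i (g i j))"
      by eventually_elim (subst prod.swap, simp)
  qed
  have meas: "{\<omega> \<in> space M. (\<lambda>i. profile m X i \<omega>) = g} \<in> sets M" for g
  proof -
    have "{\<omega> \<in> space M. \<forall>i\<in>UNIV. profile m X i \<omega> = g i} \<in> sets M"
      using profile_meas by (intro sets.sets_Collect_finite_All) auto
    then show ?thesis by (simp add: fun_eq_iff[of _ g])
  qed
  have sum: "AE \<omega> in M. cprob M G (\<lambda>\<omega>'. (\<lambda>i. profile m X i \<omega>') \<in> ?T) \<omega>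
      = (\<Sum>g\<in>?T. cprob M G (\<lambda>\<omega>'. (\<lambda>i. profile m X i \<omega>') = g) \<omega>)"
    by (intro cprob_range_sum[OF G finT meas])
  have "{\<omega> \<in> space M. (\<lambda>i. profile m X i \<omega>) \<in> ?T} = {\<omega> \<in> space M. \<forall>i. Q i (profile m X i \<omega>)}"
    using profile_sign by (auto simp: A_def PiE_UNIV_domain)
  then have eq: "cprob M G (\<lambda>\<omega>'. (\<lambda>i. profile m X i \<omega>') \<in> ?T)
      = cprob M G (\<lambda>\<omega>'. \<forall>i. Q i (profile m X i \<omega>'))"
    unfolding cprob_def by simp
  have "AE \<omega> in M. \<forall>i\<in>UNIV. cprob M G (\<lambda>\<omega>'. Q i (profile m X i \<omega>')) \<omega>
      = (\<Sum>h\<in>A i. \<Prod>j<m. ?q \<omega> j i (h j))"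
    unfolding A_def by (intro AE_finite_allI AE_cprob_profile_pred) auto
  with sum[unfolded eq] joint show ?thesis
    by eventually_elim (simp add: prod_sum_PiE[OF finite finA])
qed

end

section \<open>From wrong steps to expected errors\<close>

context prob_space
begin

text \<open>\<open>Z K\<close> stands for an error after \<open>K\<close> steps, and \<open>E k\<close> for the event that step \<open>k\<close> is wrong. Taking
expectations in the pathwise bound gives the result for finite \<open>K\<close>. The errors are bounded by
\<open>3 * r0\<close>, so dominated convergence carries it over to the limit, where the remainder
\<open>\<beta> ^ K * r0\<close> vanishes.\<close>

lemma expectation_error_bounds:
  fixes Z :: "nat \<Rightarrow> 'a \<Rightarrow> real"
  assumes beta: "0 \<le> \<beta>" "\<beta> < 1" and r0: "0 < r0"
    and E: "\<And>k. {\<omega> \<in> space M. E k \<omega>} \<in> sets M"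
    and Eq: "\<And>k. prob {\<omega> \<in> space M. E k \<omega>} \<le> q"
    and Z_meas: "\<And>K. Z K \<in> borel_measurable M"
    and Z_nonneg: "\<And>K \<omega>. \<omega> \<in> space M \<Longrightarrow> 0 \<le> Z K \<omega>"
    and Z_le: "\<And>K \<omega>. \<omega> \<in> space M \<Longrightarrow>
      Z K \<omega> \<le> \<beta> ^ K * r0 + (\<Sum>k<K. 2 * (1 - \<beta>) * (\<beta> ^ k * r0) * of_bool (E k \<omega>))"
    and Z_conv: "\<And>\<omega>. \<omega> \<in> space M \<Longrightarrow> convergent (\<lambda>K. Z K \<omega>)"
  shows "integrable M (Z K)" "expectation (Z K) \<le> 2 * r0 * q + \<beta> ^ K * r0"
    and "integrable M (\<lambda>\<omega>. lim (\<lambda>K. Z K \<omega>))" "expectation (\<lambda>\<omega>. lim (\<lambda>K. Z K \<omega>)) \<le> 2 * r0 * q"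
proof -
  let ?c = "\<lambda>k. 2 * (1 - \<beta>) * (\<beta> ^ k * r0)"
  let ?I = "\<lambda>k. indicator {\<omega> \<in> space M. E k \<omega>} :: 'a \<Rightarrow> real"
  have q: "0 \<le> q" using Eq[of 0] measure_nonneg order_trans by blast
  have Z_bound: "Z K \<omega> \<le> 3 * r0" if \<omega>: "\<omega> \<in> space M" for K \<omega>
  proof -
    have "(\<Sum>k<K. ?c k * of_bool (E k \<omega>)) \<le> 2 * r0 * 1"
      using beta r0 by (intro weighted_error_sum_le) auto
    moreover have "\<beta> ^ K * r0 \<le> 1 * r0"
      using beta r0 by (intro mult_right_mono power_le_one) auto
    ultimately show ?thesis using Z_le[OF \<omega>, of K] by simp
  qed
  have Z_dom: "AE \<omega> in M. norm (Z K \<omega>) \<le> 3 * r0" for K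
    using Z_nonneg Z_bound by (intro AE_I2) auto
  show int: "integrable M (Z K)" for K
    by (rule integrable_const_bound[OF Z_dom Z_meas])
  show exp: "expectation (Z K) \<le> 2 * r0 * q + \<beta> ^ K * r0" for K
  proof -
    have intI: "integrable M (?I k)" for k by (rule integrable_indicator_event[OF E])
    have const: "expectation (\<lambda>_. \<beta> ^ K * r0) = \<beta> ^ K * r0" by (simp add: prob_space)
    have "expectation (Z K) \<le> expectation (\<lambda>\<omega>. \<beta> ^ K * r0 + (\<Sum>k<K. ?c k * ?I k \<omega>))"
    proof (intro integral_mono int)
      show "integrable M (\<lambda>\<omega>. \<beta> ^ K * r0 + (\<Sum>k<K. ?c k * ?I k \<omega>))"
        using intI by (intro Bochner_Integration.integrable_add Bochner_Integration.integrable_sum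
          integrable_mult_right integrable_const)
      fix \<omega> assume "\<omega> \<in> space M"
      then show "Z K \<omega> \<le> \<beta> ^ K * r0 + (\<Sum>k<K. ?c k * ?I k \<omega>)"
        using Z_le[of \<omega> K] by (simp add: indicator_def)
    qed
    also have "\<dots> = \<beta> ^ K * r0 + expectation (\<lambda>\<omega>. \<Sum>k<K. ?c k * ?I k \<omega>)"
      using intI const by (subst Bochner_Integration.integral_add)
        (auto simp only: intro!: Bochner_Integration.integrable_sum integrable_mult_right integrable_const)
    also have "expectation (\<lambda>\<omega>. \<Sum>k<K. ?c k * ?I k \<omega>) = (\<Sum>k<K. expectation (\<lambda>\<omega>. ?c k * ?I k \<omega>))"
      using intI by (intro Bochner_Integration.integral_sum integrable_mult_right)
    also have "\<dots> = (\<Sum>k<K. ?c k * prob {\<omega> \<in> space M. E k \<omega>})"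
      using E by (simp only: integral_mult_right_zero Bochner_Integration.integral_indicator Int_absorb2
          sets.sets_into_space)
    also have "(\<Sum>k<K. ?c k * prob {\<omega> \<in> space M. E k \<omega>}) \<le> 2 * r0 * q"
      using beta r0 q Eq by (intro weighted_error_sum_le) auto
    finally show ?thesis by simp
  qed
  have lim: "AE \<omega> in M. (\<lambda>K. Z K \<omega>) \<longlonglongrightarrow> lim (\<lambda>K. Z K \<omega>)"
    using Z_conv by (intro AE_I2) (simp add: convergent_LIMSEQ_iff)
  have lim_meas: "(\<lambda>\<omega>. lim (\<lambda>K. Z K \<omega>)) \<in> borel_measurable M"
    using Z_meas by measurable
  note dct = lim_meas Z_meas integrable_const[of "3 * r0"] lim Z_dom
  show "integrable M (\<lambda>\<omega>. lim (\<lambda>K. Z K \<omega>))"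
    by (rule integrable_dominated_convergence[OF dct])
  have "(\<lambda>K. 2 * r0 * q + \<beta> ^ K * r0) \<longlonglongrightarrow> 2 * r0 * q + 0 * r0"
    using beta by (intro tendsto_intros LIMSEQ_realpow_zero) auto
  then show "expectation (\<lambda>\<omega>. lim (\<lambda>K. Z K \<omega>)) \<le> 2 * r0 * q"
    using LIMSEQ_le[OF integral_dominated_convergence[OF dct]] exp by fastforce
qed

end

section \<open>The run of the algorithm\<close>

lemma finite_sign_vectors: "finite {s :: real ^ 'n. \<forall>i. s $ i \<in> {-1, 1}}"
proof (rule finite_subset)
  show "{s :: real ^ 'n. \<forall>i. s $ i \<in> {-1, 1}} \<subseteq> vec_lambda ` (UNIV \<rightarrow>\<^sub>E {-1, 1})"
  proof
    fix s :: "real ^ 'n" assume "s \<in> {s. \<forall>i. s $ i \<in> {-1, 1}}"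
    then have "vec_nth s \<in> UNIV \<rightarrow>\<^sub>E {-1, 1}" by (auto simp: PiE_UNIV_domain)
    then show "s \<in> vec_lambda ` (UNIV \<rightarrow>\<^sub>E {-1, 1})"
      by (intro image_eqI[of _ _ "vec_nth s"]) auto
  qed
  show "finite (vec_lambda ` ((UNIV :: 'n set) \<rightarrow>\<^sub>E {-1, 1 :: real}))"
    by (intro finite_imageI finite_PiE) auto
qed

lemma sign_correct_majority:
  "sign_correct f v (majority m (\<lambda>j. X j \<omega>)) i \<longleftrightarrow>
     (pderiv_at i f v \<noteq> 0 \<longrightarrow> vote m (profile m X i \<omega>) = sgn (pderiv_at i f v))"
  by (simp add: sign_correct_def majority_profile)

locale cube_vote_run = prob_space M for M :: "'a measure" +
  fixes w c0 xs :: "real ^ 'n" and \<beta> r0 \<gamma> :: real and m :: nat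
    and f :: "real ^ 'n \<Rightarrow> real"
    and H :: "nat \<Rightarrow> 'a measure" and A :: "nat \<Rightarrow> nat \<Rightarrow> 'a \<Rightarrow> real ^ 'n"
  assumes w_pos: "\<forall>i. w $ i > 0"
    and beta: "1 / 2 \<le> \<beta>" "\<beta> < 1"
    and r0_pos: "r0 > 0"
    and xs_in: "xs \<in> coord_box c0 (r0 *\<^sub>R w)"
    and f_in: "f \<in> class_U xs (coord_box c0 (r0 *\<^sub>R w))"
    and gamma_pos: "\<gamma> > 0"
    and noise_center:
      "noise_model M H m \<gamma> f A (\<lambda>k \<omega>. center \<beta> r0 w c0 m (\<lambda>k j. A k j \<omega>) k)"
begin

definition c :: "nat \<Rightarrow> 'a \<Rightarrow> real ^ 'n" where
  "c k \<omega> = center \<beta> r0 w c0 m (\<lambda>k j. A k j \<omega>) k"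

lemma noise: "noise_model M H m \<gamma> f A c"
  using noise_center unfolding c_def[abs_def] .

definition err :: "nat \<Rightarrow> 'n \<Rightarrow> 'a \<Rightarrow> real" where
  "err k i \<omega> = \<bar>c k \<omega> $ i - xs $ i\<bar> / w $ i"

definition maxerr :: "nat \<Rightarrow> 'a \<Rightarrow> real" where
  "maxerr k \<omega> = max_err w xs (c k \<omega>)"

definition correct :: "nat \<Rightarrow> 'n \<Rightarrow> 'a \<Rightarrow> bool" where
  "correct k i \<omega> \<longleftrightarrow> sign_correct f (c k \<omega>) (majority m (\<lambda>j. A k j \<omega>)) i"

lemma c_Suc: "c (Suc k) \<omega> $ i =
    c k \<omega> $ i - (1 - \<beta>) * (\<beta> ^ k * r0) * w $ i * majority m (\<lambda>j. A k j \<omega>) $ i"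
  by (simp add: c_def)

lemma subalg: "subalgebra M (H k)"
  and answer_adapted: "j < m \<Longrightarrow> A k j \<in> borel_measurable (H (Suc k))"
  and answer_sign: "j < m \<Longrightarrow> \<omega> \<in> space M \<Longrightarrow> A k j \<omega> $ i \<in> {-1, 1}"
  and answer_bias: "j < m \<Longrightarrow> AE \<omega> in M. pderiv_at i f (c k \<omega>) \<noteq> 0 \<longrightarrow>
        1 / 2 + \<gamma> \<le> cprob M (H k) (\<lambda>\<omega>'. A k j \<omega>' $ i = sgn (pderiv_at i f (c k \<omega>'))) \<omega>"
  and answers_indep: "cond_indep_family M (H k) borel {..<m} (A k)"
  using noise unfolding noise_model_def by (auto simp del: insert_iff)

lemma space_H: "space (H k) = space M"
  using subalg by (simp add: subalgebra_def)

lemma H_Suc: "sets (H k) \<subseteq> sets (H (Suc k))"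
  using noise filtration.sets_F_mono[of "space M" H k "Suc k"] by (simp add: noise_model_def)

lemma round: "query_round M (H k) m (A k)"
proof
  show "subalgebra M (H k)" by (rule subalg)
  show "j < m \<Longrightarrow> A k j \<in> borel_measurable M" for j
    by (rule measurable_from_subalg[OF subalg answer_adapted])
qed (use answer_sign answers_indep in auto)

lemma majority_adapted:
  "(\<lambda>\<omega>. majority m (\<lambda>j. A k j \<omega>) $ i) \<in> borel_measurable (H (Suc k))"
proof -
  have "{\<omega> \<in> space (H (Suc k)). vote m (profile m (A k) i \<omega>) = 1} \<in> sets (H (Suc k))"
    using answer_adapted answer_sign by (intro sets_profile_pred) (auto simp: space_H)
  then have "(\<lambda>\<omega>. if vote m (profile m (A k) i \<omega>) = 1 then 1 else -1 :: real)
      \<in> borel_measurable (H (Suc k))"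
    by (intro measurable_If) auto
  also have "(\<lambda>\<omega>. if vote m (profile m (A k) i \<omega>) = 1 then 1 else -1)
      = (\<lambda>\<omega>. majority m (\<lambda>j. A k j \<omega>) $ i)"
    by (auto simp: majority_profile vote_def)
  finally show ?thesis .
qed

lemma c_adapted: "(\<lambda>\<omega>. c k \<omega> $ i) \<in> borel_measurable (H k)"
proof (induction k)
  case 0
  then show ?case by (simp add: c_def)
next
  case (Suc k)
  have "(\<lambda>\<omega>. c k \<omega> $ i) \<in> borel_measurable (H (Suc k))"
    using Suc H_Suc[of k] space_H
    by (intro measurable_from_subalg[of "H (Suc k)" "H k"]) (simp_all add: subalgebra_def)
  with majority_adapted[of k i] show ?case
    by (simp add: c_Suc)
qed

lemma c_eq_sets: "{\<omega> \<in> space M. c k \<omega> = v} \<in> sets (H k)"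
proof -
  have "{\<omega> \<in> space (H k). \<forall>i\<in>UNIV. c k \<omega> $ i = v $ i} \<in> sets (H k)"
  proof (intro sets.sets_Collect_finite_All)
    show "{\<omega> \<in> space (H k). c k \<omega> $ i = v $ i} \<in> sets (H k)" for i
      using c_adapted[of k i] by measurable
  qed simp
  then show ?thesis by (simp add: vec_eq_iff space_H)
qed

text \<open>A center is determined by the finitely many majority signs of the earlier steps. Every function of the
center, in particular each partial derivative of \<open>f\<close> at it, is therefore constant on the finitely many
events \<open>c k = v\<close> of the history, and measurable for this reason alone.\<close>

lemma finite_c: "finite (c k ` space M)"
proof (induction k)
  case 0
  have "c 0 ` space M \<subseteq> {c0}" by (auto simp: c_def)
  then show ?case by (rule finite_subset) simp
next
  case (Suc k)
  let ?g = "\<lambda>(v, s). v - (\<chi> i. (1 - \<beta>) * (\<beta> ^ k * r0) * w $ i * s $ i)"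
  have "c (Suc k) ` space M \<subseteq> ?g ` (c k ` space M \<times> {s :: real ^ 'n. \<forall>i. s $ i \<in> {-1, 1}})"
  proof
    fix v assume "v \<in> c (Suc k) ` space M"
    then obtain \<omega> where \<omega>: "\<omega> \<in> space M" "v = c (Suc k) \<omega>" by auto
    then show "v \<in> ?g ` (c k ` space M \<times> {s :: real ^ 'n. \<forall>i. s $ i \<in> {-1, 1}})"
      using majority_sign
      by (intro image_eqI[of _ _ "(c k \<omega>, majority m (\<lambda>j. A k j \<omega>))"]) (auto simp: c_def)
  qed
  then show ?case
    by (rule finite_subset) (intro finite_imageI finite_cartesian_product Suc finite_sign_vectors)
qed

lemma freeze:
  assumes "\<And>v. {\<omega> \<in> space M. P v \<omega>} \<in> sets M"
  shows "{\<omega> \<in> space M. P (c k \<omega>) \<omega>} \<in> sets M"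
    and "AE \<omega> in M. cprob M (H k) (\<lambda>\<omega>'. P (c k \<omega>') \<omega>') \<omega> = cprob M (H k) (P (c k \<omega>)) \<omega>"
  using cprob_freeze[where P = P, OF subalg finite_c c_eq_sets assms] by blast+

lemma c_in_box: "c k \<omega> \<in> coord_box c0 (r0 *\<^sub>R w)"
  unfolding c_def using beta r0_pos w_pos by (intro center_in_box) auto

text \<open>All centers lie in the box, so at a center off the target in coordinate \<open>i\<close> a correct sign is the
sign of the error. The general bound for a shrinking sequence of steps applies.\<close>

lemma err_le_sum_wrong:
  assumes "\<And>k. k < K \<Longrightarrow> k \<notin> E \<Longrightarrow> correct k i \<omega>"
  shows "err K i \<omega> \<le> \<beta> ^ K * r0 + (\<Sum>k<K. 2 * (1 - \<beta>) * (\<beta> ^ k * r0) * indicator E k)"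
proof -
  define e where "e k = (c k \<omega> $ i - xs $ i) / w $ i" for k
  have wi: "w $ i > 0" using w_pos by simp
  have "\<bar>e K\<bar> \<le> \<beta> ^ K * r0 + (\<Sum>k<K. 2 * (1 - \<beta>) * (\<beta> ^ k * r0) * indicator E k)"
  proof (rule abs_error_le_sum_wrong[OF beta r0_pos, where s = "\<lambda>k. majority m (\<lambda>j. A k j \<omega>) $ i"])
    show "e (Suc k) = e k - (1 - \<beta>) * (\<beta> ^ k * r0) * majority m (\<lambda>j. A k j \<omega>) $ i" for k
      using wi by (simp add: e_def c_Suc field_simps)
    show "\<bar>e 0\<bar> \<le> r0"
      using xs_in wi by (simp add: e_def c_def coord_box_def divide_le_eq abs_minus_commute)
    show "majority m (\<lambda>j. A k j \<omega>) $ i = sgn (e k)" if "k < K" "k \<notin> E" "e k \<noteq> 0" for k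
    proof -
      have "c k \<omega> $ i \<noteq> xs $ i" using that by (auto simp: e_def)
      with assms[OF that(1,2)] have "majority m (\<lambda>j. A k j \<omega>) $ i = sgn (c k \<omega> $ i - xs $ i)"
        using sign_from_class_U[OF f_in c_in_box] by (simp add: correct_def sign_correct_def)
      also have "\<dots> = sgn (e k)" using wi by (simp add: e_def sgn_divide)
      finally show ?thesis .
    qed
  qed (rule majority_sign)
  then show ?thesis using wi by (simp add: e_def err_def)
qed

lemma maxerr_le_sum_wrong:
  assumes "\<And>k i. k < K \<Longrightarrow> k \<notin> E \<Longrightarrow> correct k i \<omega>"
  shows "maxerr K \<omega> \<le> \<beta> ^ K * r0 + (\<Sum>k<K. 2 * (1 - \<beta>) * (\<beta> ^ k * r0) * indicator E k)"
  using err_le_sum_wrong[where K = K and E = E and \<omega> = \<omega>, OF assms] by (simp add: maxerr_def max_err_le_iff err_def)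

lemma c_meas: "(\<lambda>\<omega>. c k \<omega> $ i) \<in> borel_measurable M"
  by (rule measurable_from_subalg[OF subalg c_adapted])

lemma err_meas: "err k i \<in> borel_measurable M"
  unfolding err_def[abs_def] using c_meas by measurable

lemma maxerr_eq: "maxerr k \<omega> = Max (range (\<lambda>i. err k i \<omega>))"
  by (simp add: maxerr_def max_err_def err_def)

lemma maxerr_meas: "maxerr k \<in> borel_measurable M"
  using borel_measurable_Max[of UNIV "err k" M] err_meas
  by (simp add: maxerr_eq[abs_def])

lemma err_nonneg: "0 \<le> err k i \<omega>"
  using w_pos by (simp add: err_def less_imp_le)

lemma maxerr_nonneg: "0 \<le> maxerr k \<omega>"
  using err_nonneg[of k undefined \<omega>] by (simp add: maxerr_eq Max_ge_iff) blast

lemma err_LIMSEQ: "(\<lambda>k. err k i \<omega>) \<longlonglongrightarrow> lim (\<lambda>k. err k i \<omega>)"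
proof -
  have "convergent (\<lambda>k. c k \<omega> $ i)"
    unfolding c_def using beta r0_pos w_pos by (intro convergent_center) auto
  then obtain L where "(\<lambda>k. c k \<omega> $ i) \<longlonglongrightarrow> L" by (auto simp: convergent_def)
  then have "(\<lambda>k. err k i \<omega>) \<longlonglongrightarrow> \<bar>L - xs $ i\<bar> / w $ i"
    unfolding err_def using w_pos[THEN spec, of i] by (intro tendsto_intros) auto
  then show ?thesis by (simp add: limI)
qed

lemma err_convergent: "convergent (\<lambda>k. err k i \<omega>)"
  using err_LIMSEQ by (auto simp: convergent_def)

lemma maxerr_convergent: "convergent (\<lambda>k. maxerr k \<omega>)"
  unfolding maxerr_eq using tendsto_Max_range[where u = "\<lambda>k i. err k i \<omega>", OF err_LIMSEQ] by (auto simp: convergent_def)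

lemma sets_correct_at:
  "{\<omega> \<in> space M. sign_correct f v (majority m (\<lambda>j. A k j \<omega>)) i} \<in> sets M"
  unfolding sign_correct_majority by (rule query_round.profile_pred_meas[OF round])

lemma sets_not_correct_at:
  "{\<omega> \<in> space M. \<not> sign_correct f v (majority m (\<lambda>j. A k j \<omega>)) i} \<in> sets M"
  unfolding sign_correct_majority by (rule query_round.profile_pred_meas[OF round])

lemma freeze_wrong:
  "AE \<omega> in M. cprob M (H k) (\<lambda>\<omega>'. \<not> sign_correct f (c k \<omega>') (majority m (\<lambda>j. A k j \<omega>')) i) \<omega>
    = cprob M (H k) (\<lambda>\<omega>'. \<not> sign_correct f (c k \<omega>) (majority m (\<lambda>j. A k j \<omega>')) i) \<omega>"
  by (rule freeze(2)) (rule sets_not_correct_at)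

lemma sets_correct: "{\<omega> \<in> space M. correct k i \<omega>} \<in> sets M"
  unfolding correct_def by (rule freeze(1)) (rule sets_correct_at)

lemma sets_some_wrong: "{\<omega> \<in> space M. \<exists>i. \<not> correct k i \<omega>} \<in> sets M"
proof -
  have "{\<omega> \<in> space M. \<exists>i\<in>UNIV. \<not> correct k i \<omega>} \<in> sets M"
    using sets_correct by (intro sets.sets_Collect_finite_Ex sets.sets_Collect_neg) auto
  then show ?thesis by simp
qed

text \<open>Given the history, the queried center and with it the sign to be found are constants, so the tail
bound for a fixed sign applies at almost every outcome.\<close>

lemma majority_err_bound_hoeffding: "majority_err_bound M H m f A c (exp (- 2 * \<gamma>\<^sup>2 * real m))"
  unfolding majority_err_bound_def
proof (intro allI)
  fix k i
  interpret query_round M "H k" m "A k" by (rule round)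
  let ?D = "\<lambda>\<omega>. pderiv_at i f (c k \<omega>)"
  have bias: "AE \<omega> in M. \<forall>j\<in>{..<m}. ?D \<omega> \<noteq> 0 \<longrightarrow>
      1 / 2 + \<gamma> \<le> cprob M (H k) (\<lambda>\<omega>'. A k j \<omega>' $ i = sgn (?D \<omega>)) \<omega>"
  proof (rule AE_finite_allI)
    fix j assume "j \<in> {..<m}"
    then have j: "j < m" by simp
    show "AE \<omega> in M. ?D \<omega> \<noteq> 0 \<longrightarrow>
        1 / 2 + \<gamma> \<le> cprob M (H k) (\<lambda>\<omega>'. A k j \<omega>' $ i = sgn (?D \<omega>)) \<omega>"
      using answer_bias[OF j, of i k]
        freeze(2)[where k = k and P = "\<lambda>v \<omega>'. A k j \<omega>' $ i = sgn (pderiv_at i f v)",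
          OF answer_meas[OF j]]
      by eventually_elim simp
  qed simp
  show "AE \<omega> in M. ?D \<omega> \<noteq> 0 \<longrightarrow>
      cprob M (H k) (\<lambda>\<omega>'. \<not> sign_correct f (c k \<omega>') (majority m (\<lambda>j. A k j \<omega>')) i) \<omega>
      \<le> exp (- 2 * \<gamma>\<^sup>2 * real m)"
    using bias AE_vote_tail[OF gamma_pos, of i]
      freeze_wrong[of k i]
    by eventually_elim (auto simp: sign_correct_majority sgn_real_def)
qed

text \<open>If the first center agrees with the target in coordinate \<open>i\<close>, then the first step leaves it, whatever
the answers are.\<close>

lemma some_center_off_target: "\<exists>k. \<forall>\<omega>. c k \<omega> $ i \<noteq> xs $ i"
proof (cases "c0 $ i = xs $ i")
  case True
  have "(1 - \<beta>) * r0 * w $ i \<noteq> 0"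
    using beta r0_pos w_pos[THEN spec, of i] by auto
  then have "c (Suc 0) \<omega> $ i \<noteq> xs $ i" for \<omega>
    using True majority_sign[of m "\<lambda>j. A 0 j \<omega>" i] by (auto simp: c_def)
  then show ?thesis by blast
next
  case False
  then show ?thesis by (intro exI[of _ 0]) (simp add: c_def)
qed

text \<open>The bound \<open>p\<close> is required only where the partial derivative does not vanish. Where it vanishes no error is
possible, so the bound extends to all outcomes once \<open>p \<ge> 0\<close>. The latter follows because some center is off
the target, where the derivative is nonzero and \<open>p\<close> dominates a probability.\<close>

lemma AE_cprob_wrong_le:
  assumes "majority_err_bound M H m f A c p"
  shows "0 \<le> p" "AE \<omega> in M. cprob M (H k) (\<lambda>\<omega>'. \<not> correct k i \<omega>') \<omega> \<le> p"
proof -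
  have bound: "AE \<omega> in M. pderiv_at i f (c k \<omega>) \<noteq> 0 \<longrightarrow>
      cprob M (H k) (\<lambda>\<omega>'. \<not> correct k i \<omega>') \<omega> \<le> p" for k i
    using assms by (simp add: majority_err_bound_def correct_def)
  have sets_wrong: "{\<omega> \<in> space M. \<not> correct k i \<omega>} \<in> sets M" for k i
    using sets_correct by (intro sets.sets_Collect_neg)
  show p: "0 \<le> p"
  proof -
    obtain k where k: "\<And>\<omega>. c k \<omega> $ undefined \<noteq> xs $ undefined" using some_center_off_target by blast
    have "AE \<omega> in M. 0 \<le> p"
      using bound[of undefined k] cprob_nonneg[OF subalg[of k] sets_wrong[of k undefined]]
      by eventually_elim (use sign_from_class_U(2)[OF f_in c_in_box k] in fastforce)
    then show ?thesis by simp
  qed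
  have trivial: "AE \<omega> in M. cprob M (H k) (\<lambda>_. \<not> True) \<omega> = 0"
    using cprob_not[OF subalg, of "\<lambda>_. True" k] cprob_space[OF subalg, of "\<lambda>_. True" k]
    by (auto elim: eventually_elim2)
  show "AE \<omega> in M. cprob M (H k) (\<lambda>\<omega>'. \<not> correct k i \<omega>') \<omega> \<le> p"
    using bound[of i k] freeze_wrong[of k i] trivial
  proof eventually_elim
    case (elim \<omega>)
    show ?case
    proof (cases "pderiv_at i f (c k \<omega>) = 0")
      case True
      then have "(\<lambda>\<omega>'. \<not> sign_correct f (c k \<omega>) (majority m (\<lambda>j. A k j \<omega>')) i) = (\<lambda>_. \<not> True)"
        by (simp add: sign_correct_def)
      then show ?thesis using elim p by (simp add: correct_def)
    next
      case False
      then show ?thesis using elim by simp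
    qed
  qed
qed

lemma prob_wrong_le:
  assumes "majority_err_bound M H m f A c p"
  shows "prob {\<omega> \<in> space M. \<not> correct k i \<omega>} \<le> p"
  using AE_cprob_wrong_le(2)[OF assms] sets_correct
  by (intro prob_le_of_cprob_le[OF subalg[of k]] sets.sets_Collect_neg) auto

lemma prob_some_wrong_le:
  assumes "majority_err_bound M H m f A c p"
  shows "prob {\<omega> \<in> space M. \<exists>i. \<not> correct k i \<omega>} \<le> min 1 (real CARD('n) * p)"
proof -
  have "prob {\<omega> \<in> space M. \<exists>i. \<not> correct k i \<omega>}
      = prob (\<Union>i\<in>UNIV. {\<omega> \<in> space M. \<not> correct k i \<omega>})"
    by (rule arg_cong[of _ _ prob]) auto
  also have "\<dots> \<le> (\<Sum>i\<in>UNIV. prob {\<omega> \<in> space M. \<not> correct k i \<omega>})"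
    using sets_correct by (intro finite_measure_subadditive_finite) (auto intro!: sets.sets_Collect_neg)
  also have "\<dots> \<le> real CARD('n) * p"
    using sum_bounded_above[of "UNIV :: 'n set" _ p] prob_wrong_le[OF assms] by simp
  finally show ?thesis using prob_le_1 by simp
qed

text \<open>With the center frozen, the correctness of different coordinates is independent, and each has conditional
probability at least \<open>1 - p\<close>. The factors can be multiplied because \<open>p \<le> 1\<close>.\<close>

lemma prob_some_wrong_le_indep:
  assumes p: "majority_err_bound M H m f A c p" "p \<le> 1"
    and coords: "indep_across_coords M H m A"
  shows "prob {\<omega> \<in> space M. \<exists>i. \<not> correct k i \<omega>} \<le> 1 - (1 - p) ^ CARD('n)"
proof -
  interpret query_round M "H k" m "A k" by (rule round)
  let ?C = "\<lambda>v i \<omega>. sign_correct f v (majority m (\<lambda>j. A k j \<omega>)) i"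
  have all_at: "{\<omega> \<in> space M. \<forall>i. ?C v i \<omega>} \<in> sets M" for v
    using sets.sets_Collect_finite_All[OF sets_correct_at, of "UNIV :: 'n set"] by simp
  have prod: "AE \<omega> in M. \<forall>v\<in>c k ` space M. cprob M (H k) (\<lambda>\<omega>'. \<forall>i. ?C v i \<omega>') \<omega>
      = (\<Prod>i\<in>UNIV. cprob M (H k) (?C v i) \<omega>)"
    unfolding sign_correct_majority using coords
    by (intro AE_finite_allI finite_c AE_cprob_profiles_indep) (auto simp: indep_across_coords_def)
  have each: "AE \<omega> in M. \<forall>i\<in>UNIV. 1 - p \<le> cprob M (H k) (?C (c k \<omega>) i) \<omega>"
  proof (rule AE_finite_allI)
    fix i
    show "AE \<omega> in M. 1 - p \<le> cprob M (H k) (?C (c k \<omega>) i) \<omega>"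
      using AE_cprob_wrong_le(2)[OF p(1), of k i] cprob_not[OF subalg[of k] sets_correct[of k i]]
        freeze(2)[where k = k and P = "\<lambda>v. ?C v i", OF sets_correct_at]
      by eventually_elim (simp add: correct_def)
  qed simp
  have "AE \<omega> in M. (1 - p) ^ CARD('n) \<le> cprob M (H k) (\<lambda>\<omega>'. \<forall>i. correct k i \<omega>') \<omega>"
    using prod each freeze(2)[where k = k and P = "\<lambda>v \<omega>. \<forall>i. ?C v i \<omega>", OF all_at] AE_space
  proof eventually_elim
    case (elim \<omega>)
    have "(1 - p) ^ CARD('n) = (\<Prod>i\<in>(UNIV :: 'n set). 1 - p)" by simp
    also have "\<dots> \<le> (\<Prod>i\<in>UNIV. cprob M (H k) (?C (c k \<omega>) i) \<omega>)"
      using elim p by (intro prod_mono) auto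
    also have "\<dots> = cprob M (H k) (\<lambda>\<omega>'. \<forall>i. correct k i \<omega>') \<omega>"
      using elim by (simp add: correct_def)
    finally show ?case .
  qed
  moreover have sets_all: "{\<omega> \<in> space M. \<forall>i. correct k i \<omega>} \<in> sets M"
    unfolding correct_def by (rule freeze(1)) (rule all_at)
  ultimately have "(1 - p) ^ CARD('n) \<le> prob {\<omega> \<in> space M. \<forall>i. correct k i \<omega>}"
    by (intro prob_ge_of_cprob_ge[OF subalg[of k]])
  with prob_neg[OF sets_all] show ?thesis by simp
qed

lemma err_bounds:
  assumes "majority_err_bound M H m f A c p"
  shows "integrable M (\<lambda>\<omega>. lim (\<lambda>k. err k i \<omega>))"
    and "expectation (\<lambda>\<omega>. lim (\<lambda>k. err k i \<omega>)) \<le> 2 * r0 * p"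
proof -
  have le: "err K i \<omega> \<le> \<beta> ^ K * r0 +
      (\<Sum>k<K. 2 * (1 - \<beta>) * (\<beta> ^ k * r0) * of_bool (\<not> correct k i \<omega>))" for K \<omega>
    using err_le_sum_wrong[of K "{k. \<not> correct k i \<omega>}" i \<omega>] by (simp add: indicator_def)
  have sets: "{\<omega> \<in> space M. \<not> correct k i \<omega>} \<in> sets M" for k
    using sets_correct by (intro sets.sets_Collect_neg)
  show "integrable M (\<lambda>\<omega>. lim (\<lambda>k. err k i \<omega>))"
    and "expectation (\<lambda>\<omega>. lim (\<lambda>k. err k i \<omega>)) \<le> 2 * r0 * p"
    using expectation_error_bounds(3,4)[OF _ beta(2) r0_pos sets prob_wrong_le[OF assms]
        err_meas err_nonneg le err_convergent] beta by simp_all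
qed

lemma maxerr_bounds:
  assumes "\<And>k. prob {\<omega> \<in> space M. \<exists>i. \<not> correct k i \<omega>} \<le> q"
  shows "integrable M (maxerr K)" "expectation (maxerr K) \<le> 2 * r0 * q + \<beta> ^ K * r0"
    and "integrable M (\<lambda>\<omega>. lim (\<lambda>k. maxerr k \<omega>))"
    and "expectation (\<lambda>\<omega>. lim (\<lambda>k. maxerr k \<omega>)) \<le> 2 * r0 * q"
proof -
  have le: "maxerr K \<omega> \<le> \<beta> ^ K * r0 +
      (\<Sum>k<K. 2 * (1 - \<beta>) * (\<beta> ^ k * r0) * of_bool (\<exists>i. \<not> correct k i \<omega>))" for K \<omega>
    using maxerr_le_sum_wrong[of K "{k. \<exists>i. \<not> correct k i \<omega>}" \<omega>] by (simp add: indicator_def)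
  have b: "0 \<le> \<beta>" using beta by simp
  show "integrable M (maxerr K)" "expectation (maxerr K) \<le> 2 * r0 * q + \<beta> ^ K * r0"
    and "integrable M (\<lambda>\<omega>. lim (\<lambda>k. maxerr k \<omega>))"
    and "expectation (\<lambda>\<omega>. lim (\<lambda>k. maxerr k \<omega>)) \<le> 2 * r0 * q"
    using expectation_error_bounds[OF b beta(2) r0_pos sets_some_wrong assms
        maxerr_meas maxerr_nonneg le maxerr_convergent] by simp_all
qed

text \<open>Union bound over \<open>K\<close> steps and all coordinates. On the complement no step is wrong, and the pathwise
bound reduces to the radius.\<close>

lemma prob_all_correct:
  assumes delta: "0 < \<delta>" "\<delta> < 1"
    and m_large: "real m \<ge> 1 / (2 * \<gamma>\<^sup>2) * ln (real CARD('n) * real K / \<delta>)"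
  shows "1 - \<delta> \<le> prob {\<omega> \<in> space M. (\<forall>k<K. \<forall>i. correct k i \<omega>) \<and> maxerr K \<omega> \<le> \<beta> ^ K * r0}"
proof -
  let ?p = "exp (- 2 * \<gamma>\<^sup>2 * real m)"
  let ?W = "\<Union>k<K. {\<omega> \<in> space M. \<exists>i. \<not> correct k i \<omega>}"
  have W: "?W \<in> sets M" using sets_some_wrong by auto
  have small: "real K * (real CARD('n) * ?p) \<le> \<delta>"
  proof (cases "K = 0")
    case False
    let ?x = "real CARD('n) * real K / \<delta>"
    have x: "0 < ?x" using False delta by simp
    have "ln ?x \<le> 2 * \<gamma>\<^sup>2 * real m"
      using m_large gamma_pos by (simp add: field_simps)
    then have "?x \<le> exp (2 * \<gamma>\<^sup>2 * real m)"
      using x exp_le_cancel_iff[of "ln ?x"] by simp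
    then have "?x * ?p \<le> exp (2 * \<gamma>\<^sup>2 * real m) * ?p"
      by (intro mult_right_mono) auto
    also have "\<dots> = 1" by (simp flip: exp_add)
    finally show ?thesis using delta by (simp add: field_simps)
  qed (use delta in simp)
  have "prob ?W \<le> (\<Sum>k<K. prob {\<omega> \<in> space M. \<exists>i. \<not> correct k i \<omega>})"
    using sets_some_wrong by (intro finite_measure_subadditive_finite) auto
  also have "\<dots> \<le> real K * (real CARD('n) * ?p)"
    using sum_bounded_above[of "{..<K}" "\<lambda>k. prob {\<omega> \<in> space M. \<exists>i. \<not> correct k i \<omega>}"]
      prob_some_wrong_le[OF majority_err_bound_hoeffding] by simp
  finally have "prob ?W \<le> \<delta>" using small by simp
  then have "1 - \<delta> \<le> prob (space M - ?W)" using prob_compl[OF W] by simp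
  also have "space M - ?W = {\<omega> \<in> space M. (\<forall>k<K. \<forall>i. correct k i \<omega>) \<and> maxerr K \<omega> \<le> \<beta> ^ K * r0}"
    using maxerr_le_sum_wrong[of K "{}"] by auto
  finally show ?thesis .
qed

end

theorem theoremE11:
  fixes w c0 xs :: "real ^ 'n"
    and \<beta> r0 \<gamma> :: real
    and m :: nat
    and f :: "real ^ 'n \<Rightarrow> real"
    and M :: "'a measure"
    and H :: "nat \<Rightarrow> 'a measure"
    and A :: "nat \<Rightarrow> nat \<Rightarrow> 'a \<Rightarrow> real ^ 'n"
    and c :: "nat \<Rightarrow> 'a \<Rightarrow> real ^ 'n"
    and err :: "nat \<Rightarrow> 'n \<Rightarrow> 'a \<Rightarrow> real"
    and maxerr :: "nat \<Rightarrow> 'a \<Rightarrow> real"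
  defines "c \<equiv> \<lambda>k \<omega>. center \<beta> r0 w c0 m (\<lambda>k j. A k j \<omega>) k"
    and "err \<equiv> \<lambda>k i \<omega>. \<bar>c k \<omega> $ i - xs $ i\<bar> / w $ i"
    and "maxerr \<equiv> \<lambda>k \<omega>. max_err w xs (c k \<omega>)"
  assumes w_pos: "\<forall>i. w $ i > 0"
    and beta: "1 / 2 \<le> \<beta>" "\<beta> < 1"
    and r0_pos: "r0 > 0"
    and xs_in: "xs \<in> coord_box c0 (r0 *\<^sub>R w)"
    and f_in: "f \<in> class_U xs (coord_box c0 (r0 *\<^sub>R w))"
    and m_odd: "odd m"
    and gamma_pos: "\<gamma> > 0"
    and prob: "prob_space M"
    and noise: "noise_model M H m \<gamma> f A c"
  shows
    "majority_err_bound M H m f A c (exp (- 2 * \<gamma>\<^sup>2 * real m))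
     \<and> (\<forall>p. majority_err_bound M H m f A c p \<longrightarrow>
          (\<forall>i. (\<forall>\<omega>\<in>space M. convergent (\<lambda>k. err k i \<omega>)) \<and>
               integrable M (\<lambda>\<omega>. lim (\<lambda>k. err k i \<omega>)) \<and>
               (LINT \<omega>|M. lim (\<lambda>k. err k i \<omega>)) \<le> 2 * p * r0)
        \<and> (\<forall>\<omega>\<in>space M. convergent (\<lambda>k. maxerr k \<omega>))
        \<and> integrable M (\<lambda>\<omega>. lim (\<lambda>k. maxerr k \<omega>))
        \<and> (\<forall>K. integrable M (maxerr K))
        \<and> (LINT \<omega>|M. lim (\<lambda>k. maxerr k \<omega>)) \<le> 2 * r0 * min 1 (real CARD('n) * p)
        \<and> (\<forall>K. (LINT \<omega>|M. maxerr K \<omega>) \<le> 2 * r0 * min 1 (real CARD('n) * p) + \<beta> ^ K * r0)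
        \<and> (indep_across_coords M H m A \<and> p \<le> 1 \<longrightarrow>
             (LINT \<omega>|M. lim (\<lambda>k. maxerr k \<omega>)) \<le> 2 * r0 * (1 - (1 - p) ^ CARD('n)) \<and>
             (\<forall>K. (LINT \<omega>|M. maxerr K \<omega>) \<le>
                    2 * r0 * (1 - (1 - p) ^ CARD('n)) + \<beta> ^ K * r0)))
     \<and> (\<forall>K \<delta>. 0 < \<delta> \<and> \<delta> < 1 \<and>
             real m \<ge> 1 / (2 * \<gamma>\<^sup>2) * ln (real CARD('n) * real K / \<delta>) \<longrightarrow>
          measure M {\<omega> \<in> space M.
              (\<forall>k<K. \<forall>i. sign_correct f (c k \<omega>) (majority m (\<lambda>j. A k j \<omega>)) i) \<and>
              maxerr K \<omega> \<le> \<beta> ^ K * r0} \<ge> 1 - \<delta>)"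
proof -
  interpret prob_space M by (rule prob)
  interpret run: cube_vote_run M w c0 xs \<beta> r0 \<gamma> m f H A
    using w_pos beta r0_pos xs_in f_in gamma_pos noise unfolding c_def by unfold_locales
  have c: "c = run.c" by (simp add: c_def run.c_def fun_eq_iff)
  have err: "err = run.err" by (simp add: err_def run.err_def c fun_eq_iff)
  have maxerr: "maxerr = run.maxerr" by (simp add: maxerr_def run.maxerr_def c fun_eq_iff)
  show ?thesis
    unfolding err maxerr c
  proof (intro conjI allI impI ballI run.majority_err_bound_hoeffding run.err_convergent run.maxerr_convergent)
    fix p assume p: "majority_err_bound M H m f A run.c p"
    note * = run.maxerr_bounds[OF run.prob_some_wrong_le[OF p]]
    show "integrable M (\<lambda>\<omega>. lim (\<lambda>k. run.err k i \<omega>))"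
      "(LINT \<omega>|M. lim (\<lambda>k. run.err k i \<omega>)) \<le> 2 * p * r0" for i
      using run.err_bounds[OF p, of i] by (simp_all add: mult_ac)
    show "integrable M (\<lambda>\<omega>. lim (\<lambda>k. run.maxerr k \<omega>))" "integrable M (run.maxerr K)"
      "(LINT \<omega>|M. lim (\<lambda>k. run.maxerr k \<omega>)) \<le> 2 * r0 * min 1 (real CARD('n) * p)"
      "(LINT \<omega>|M. run.maxerr K \<omega>) \<le> 2 * r0 * min 1 (real CARD('n) * p) + \<beta> ^ K * r0" for K
      using * by simp_all
    assume ind: "indep_across_coords M H m A \<and> p \<le> 1"
    note ** = run.maxerr_bounds[OF run.prob_some_wrong_le_indep[OF p]]
    show "(LINT \<omega>|M. lim (\<lambda>k. run.maxerr k \<omega>)) \<le> 2 * r0 * (1 - (1 - p) ^ CARD('n))"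
      "(LINT \<omega>|M. run.maxerr K \<omega>) \<le> 2 * r0 * (1 - (1 - p) ^ CARD('n)) + \<beta> ^ K * r0" for K
      using ** ind by simp_all
  next
    fix K \<delta>
    assume "0 < \<delta> \<and> \<delta> < 1 \<and>
      real m \<ge> 1 / (2 * \<gamma>\<^sup>2) * ln (real CARD('n) * real K / \<delta>)"
    then show "1 - \<delta> \<le> measure M {\<omega> \<in> space M.
        (\<forall>k<K. \<forall>i. sign_correct f (run.c k \<omega>) (majority m (\<lambda>j. A k j \<omega>)) i) \<and>
        run.maxerr K \<omega> \<le> \<beta> ^ K * r0}"
      using run.prob_all_correct[of \<delta> K] by (simp add: run.correct_def)
  qed
qed

end
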